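(* Let $\mathbf{H}:\omega\to\omega$ be (strictly) increasing with $\mathbf{H}(0)\ge2$ (each integer $\mathbf{H}(i)$ being identified with the set $\{0,\dots,\mathbf{H}(i)-1\}$), and let $g:\mathbb{R}^{\ge0}\to\mathbb{R}^{\ge0}$ be an unbounded non-decreasing function. Let $K^{\mathbf{H}}_g$ consist of all (forgetful) creatures $t\in\mathrm{CR}[\mathbf{H}]$ such that - $\mathbf{dis}[t]=\langle i^t,A^t\rangle$ for some $i^t<\omega$ and $\emptyset\ne A^t\subseteq\mathbf{H}(i^t)$, - $\mathbf{nor}[t]=g(|A^t|)$, $m^t_{\rm dn}=i^t$, $m^t_{\rm up}=i^t+1$ and $\mathrm{pos}(t)=A^t$, and for $t\in K^{\mathbf{H}}_g$ let $\Sigma^{\mathbf{H}}_g(t)=\{s\in K^{\mathbf{H}}_g:i^t=i^s\ \&\ A^s\subseteq A^t\}$. Then $(K^{\mathbf{H}}_g,\Sigma^{\mathbf{H}}_g)$ is a local strongly finitary good creating pair for $\mathbf{H}$, and the forcing notion $\mathbb{Q}^*_\infty(K^{\mathbf{H}}_g,\Sigma^{\mathbf{H}}_g)$ collapses $\mathfrak{c}$ onto $\aleph_0$. In particular, the forcing notion $$\mathbb{Q}=\{\langle w_n:n<\omega\rangle: w_n\subseteq2^n,\ w_n\ne\emptyset\text{ for all }n,\text{ and }\lim_{n\to\infty}|w_n|=\infty\},$$ ordered by $\bar w\le\bar w'\Leftrightarrow(\forall n\in\omega)(w'_n\subseteq w_n)$, is not proper.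
   Context: Convention: in forcing, the larger condition is the stronger one. "Collapses $\mathfrak{c}$ onto $\aleph_0$" means it forces that $2^\omega\cap\mathbf{V}$ is countable, where $\mathbf{V}$ is the ground model. In the definition of $\mathbb{Q}$, $2^n$ is regarded as a set with $2^n$ elements. $u\vartriangleleft v$ means that the sequence $v$ extends $u$. Let $\mathbf{H}$ be a function on $\omega$ with $2\le|\mathbf{H}(m)|<\omega$ for all $m$. A creature for $\mathbf{H}$ is a triple $t=(\mathbf{nor}[t],\mathbf{val}[t],\mathbf{dis}[t])$ where $\mathbf{nor}[t]\in\mathbb{R}^{\ge0}$, $\mathbf{dis}[t]$ is hereditarily countable, and for some integers $m^t_{\rm dn}<m^t_{\rm up}<\omega$, $\emptyset\ne\mathbf{val}[t]\subseteq\{\langle u,v\rangle\in\prod_{i<m^t_{\rm dn}}\mathbf{H}(i)\times\prod_{i<m^t_{\rm up}}\mathbf{H}(i):u\vartriangleleft v\}$. The family of all creatures for $\mathbf{H}$ is $\mathrm{CR}[\mathbf{H}]$. For $K\subseteq\mathrm{CR}[\mathbf{H}]$ and $\Sigma:K\to\mathcal{P}(K)$, $(K,\Sigma)$ is a good creating pair for $\mathbf{H}$ if for each $t\in K$: (a) $\mathrm{dom}(\mathbf{val}[t])=\prod_{i<m^t_{\rm dn}}\mathbf{H}(i)$; (b) $t\in\Sigma(t)$, and if $s\in\Sigma(t)$ then $\mathbf{val}[s]\subseteq\mathbf{val}[t]$ (so also $m^s_{\rm dn}=m^t_{\rm dn}$, $m^s_{\rm up}=m^t_{\rm up}$); (c)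 if $s\in\Sigma(t)$ then $\Sigma(s)\subseteq\Sigma(t)$. It is local if $m^t_{\rm up}=m^t_{\rm dn}+1$ for all $t\in K$; strongly finitary if for each $i$, $|\mathbf{H}(i)|<\omega$ and $\{t\in K:m^t_{\rm dn}=i\}$ is finite; forgetful if for all $t\in K$, $v\in\prod_{i<m^t_{\rm up}}\mathbf{H}(i)$ and $u\in\prod_{i<m^t_{\rm dn}}\mathbf{H}(i)$, $\langle v\restriction m^t_{\rm dn},v\rangle\in\mathbf{val}[t]$ implies $\langle u,u^\frown v\restriction[m^t_{\rm dn},m^t_{\rm up})\rangle\in\mathbf{val}[t]$. For forgetful $K$, $\mathrm{pos}(t)=\{v\restriction[m^t_{\rm dn},m^t_{\rm up}):\langle v\restriction m^t_{\rm dn},v\rangle\in\mathbf{val}[t]\}$. In the local forgetful case, "$\mathrm{pos}(t)=A$" with $A\subseteq\mathbf{H}(m^t_{\rm dn})$ means $\mathbf{val}[t]=\{\langle u,u^\frown\langle a\rangle\rangle:u\in\prod_{i<m^t_{\rm dn}}\mathbf{H}(i),\ a\in A\}$. For $t_0,\dots,t_n\in K$ with $m^{t_i}_{\rm up}=m^{t_{i+1}}_{\rm dn}$ ($i<n$) and $w\in\prod_{i<m^{t_0}_{\rm dn}}\mathbf{H}(i)$, let $\mathrm{pos}(w,t_0,\dots,t_n)=\{v\in\prod_{j<m^{t_n}_{\rm up}}\mathbf{H}(j): w\vartriangleleft v\ \&\ (\forall i\le n)(\langle v\restriction m^{t_i}_{\rm dn},v\restriction m^{t_i}_{\rm up}\rangle\in\mathbf{val}[t_i])\}$.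 Forcing $\mathbb{Q}^*_\infty(K,\Sigma)$: conditions are sequences $p=(w^p,t^p_0,t^p_1,\dots)$ with $t^p_i\in K$, $m^{t^p_i}_{\rm up}=m^{t^p_{i+1}}_{\rm dn}$ for all $i$, $w^p\in\prod_{i<m^{t^p_0}_{\rm dn}}\mathbf{H}(i)$ and $\lim_{n\to\infty}\mathbf{nor}[t^p_n]=\infty$. Order: $p\le q$ iff for some $i<\omega$, $w^q\in\mathrm{pos}(w^p,t^p_0,\dots,t^p_{i-1})$ (meaning $w^q=w^p$ if $i=0$) and $t^q_n\in\Sigma(t^p_{n+i})$ for all $n<\omega$. *)

theory Defs
  imports Complex_Main "HOL-Library.Countable_Set_Type" "HOL-Library.Sublist"
begin

section \<open>Forcing\<close>

text \<open>
  A forcing notion is a nonempty preordered set of conditions; \<open>le p q\<close> means that \<open>q\<close> is the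
  stronger condition.

  The ground model is the ambient logic. A sentence of the forcing language is represented by
  the predicate \<open>\<phi>\<close> on conditions for which \<open>\<phi> p\<close> says that \<open>p\<close> forces the sentence, and the
  connectives below are the clauses of the usual recursive definition of the forcing relation.
  All sentences built from \<open>f_gnd\<close>, \<open>f_mem\<close> and \<open>f_mem_fam\<close> are persistent, and \<open>\<phi> p\<close> holds as
  soon as \<open>\<phi>\<close> holds densely above \<open>p\<close>; so the simple clause for implication is the right one.

  Names are kept typed. A name for a subset of a ground model set \<open>X\<close> is a subset \<open>\<sigma>\<close> of
  \<open>X \<times> P\<close>, where \<open>(x, s) \<in> \<sigma>\<close> puts \<open>x\<close> into the interpretation of \<open>\<sigma>\<close> whenever \<open>s\<close> is in the
  generic filter. A name for a family of subsets of \<open>X\<close> is a set of pairs \<open>(\<sigma>, s)\<close> with \<open>\<sigma>\<close> a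
  name for a subset of \<open>X\<close>. Every subset (family of subsets) of \<open>X\<close> in the extension
  has a name of this form.
\<close>

locale forcing_notion =
  fixes P :: "'p set" and le :: "'p \<Rightarrow> 'p \<Rightarrow> bool"
  assumes nonempty: "P \<noteq> {}"
    and le_refl: "p \<in> P \<Longrightarrow> le p p"
    and le_trans: "p \<in> P \<Longrightarrow> q \<in> P \<Longrightarrow> r \<in> P \<Longrightarrow> le p q \<Longrightarrow> le q r \<Longrightarrow> le p r"
begin

definition forced :: "('p \<Rightarrow> bool) \<Rightarrow> bool" where
  "forced \<phi> \<longleftrightarrow> (\<forall>p\<in>P. \<phi> p)"

definition f_gnd :: "bool \<Rightarrow> 'p \<Rightarrow> bool" where
  "f_gnd b p \<longleftrightarrow> b"

definition f_and :: "('p \<Rightarrow> bool) \<Rightarrow> ('p \<Rightarrow> bool) \<Rightarrow> 'p \<Rightarrow> bool"  (infixr "\<^bold>\<and>" 35) where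
  "(\<phi> \<^bold>\<and> \<psi>) p \<longleftrightarrow> \<phi> p \<and> \<psi> p"

definition f_imp :: "('p \<Rightarrow> bool) \<Rightarrow> ('p \<Rightarrow> bool) \<Rightarrow> 'p \<Rightarrow> bool"  (infixr "\<^bold>\<longrightarrow>" 25) where
  "(\<phi> \<^bold>\<longrightarrow> \<psi>) p \<longleftrightarrow> (\<forall>q\<in>P. le p q \<longrightarrow> \<phi> q \<longrightarrow> \<psi> q)"

definition f_all :: "'i set \<Rightarrow> ('i \<Rightarrow> 'p \<Rightarrow> bool) \<Rightarrow> 'p \<Rightarrow> bool" where
  "f_all I \<phi> p \<longleftrightarrow> (\<forall>i\<in>I. \<phi> i p)"

definition f_ex :: "'i set \<Rightarrow> ('i \<Rightarrow> 'p \<Rightarrow> bool) \<Rightarrow> 'p \<Rightarrow> bool" where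
  "f_ex I \<phi> p \<longleftrightarrow> (\<forall>q\<in>P. le p q \<longrightarrow> (\<exists>r\<in>P. le q r \<and> (\<exists>i\<in>I. \<phi> i r)))"

definition names :: "'a set \<Rightarrow> ('a \<times> 'p) set set" where
  "names X = Pow (X \<times> P)"

definition check :: "'a set \<Rightarrow> ('a \<times> 'p) set" where
  "check X = X \<times> P"

definition f_mem :: "'a \<Rightarrow> ('a \<times> 'p) set \<Rightarrow> 'p \<Rightarrow> bool" where
  "f_mem x \<sigma> p \<longleftrightarrow>
     (\<forall>q\<in>P. le p q \<longrightarrow> (\<exists>r\<in>P. le q r \<and> (\<exists>s\<in>P. (x, s) \<in> \<sigma> \<and> le s r)))"

definition f_subset :: "'a set \<Rightarrow> ('a \<times> 'p) set \<Rightarrow> ('a \<times> 'p) set \<Rightarrow> 'p \<Rightarrow> bool" where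
  "f_subset X \<sigma> \<tau> = f_all X (\<lambda>x. f_mem x \<sigma> \<^bold>\<longrightarrow> f_mem x \<tau>)"

definition f_eq :: "'a set \<Rightarrow> ('a \<times> 'p) set \<Rightarrow> ('a \<times> 'p) set \<Rightarrow> 'p \<Rightarrow> bool" where
  "f_eq X \<sigma> \<tau> = (f_subset X \<sigma> \<tau> \<^bold>\<and> f_subset X \<tau> \<sigma>)"

definition f_mem_fam ::
    "'a set \<Rightarrow> ('a \<times> 'p) set \<Rightarrow> (('a \<times> 'p) set \<times> 'p) set \<Rightarrow> 'p \<Rightarrow> bool" where
  "f_mem_fam X \<sigma> C p \<longleftrightarrow>
     (\<forall>q\<in>P. le p q \<longrightarrow> (\<exists>r\<in>P. le q r \<and> (\<exists>\<tau>. \<exists>s\<in>P. (\<tau>, s) \<in> C \<and> le s r \<and> f_eq X \<sigma> \<tau> r)))"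

text \<open>
  ``\<open>\<sigma>\<close> is countable'', for a name \<open>\<sigma>\<close> of a subset of \<open>X\<close>: there is an injective partial
  function from \<open>X\<close> to \<open>\<omega>\<close> whose domain includes \<open>\<sigma>\<close>.
\<close>

definition f_countable :: "'a set \<Rightarrow> ('a \<times> 'p) set \<Rightarrow> 'p \<Rightarrow> bool" where
  "f_countable X \<sigma> =
     f_ex (names (X \<times> (UNIV :: nat set))) (\<lambda>f.
       f_all X (\<lambda>x. f_mem x \<sigma> \<^bold>\<longrightarrow> f_ex UNIV (\<lambda>n. f_mem (x, n) f))
       \<^bold>\<and> f_all X (\<lambda>x. f_all UNIV (\<lambda>m. f_all UNIV (\<lambda>n.
             f_mem (x, m) f \<^bold>\<and> f_mem (x, n) f \<^bold>\<longrightarrow> f_gnd (m = n))))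
       \<^bold>\<and> f_all X (\<lambda>x. f_all X (\<lambda>y. f_all UNIV (\<lambda>n.
             f_mem (x, n) f \<^bold>\<and> f_mem (y, n) f \<^bold>\<longrightarrow> f_gnd (x = y)))))"

definition collapses_continuum :: bool where
  "collapses_continuum \<longleftrightarrow>
     forced (f_countable (UNIV :: (nat \<Rightarrow> bool) set) (check UNIV))"

end

text \<open>
  Closed unbounded and stationary subsets of the family of countable subsets of \<open>X\<close>, first in
  the ground model and then in the forcing extension.
\<close>

definition club :: "'a set \<Rightarrow> 'a set set \<Rightarrow> bool" where
  "club X C \<longleftrightarrow>
     (\<forall>a\<in>C. a \<subseteq> X \<and> countable a)
     \<and> (\<forall>a. a \<subseteq> X \<and> countable a \<longrightarrow> (\<exists>b\<in>C. a \<subseteq> b))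
     \<and> (\<forall>b :: nat \<Rightarrow> 'a set. (\<forall>n. b n \<in> C \<and> b n \<subseteq> b (Suc n)) \<longrightarrow> (\<Union>n. b n) \<in> C)"

definition stationary :: "'a set \<Rightarrow> 'a set set \<Rightarrow> bool" where
  "stationary X S \<longleftrightarrow>
     (\<forall>a\<in>S. a \<subseteq> X \<and> countable a) \<and> (\<forall>C. club X C \<longrightarrow> (\<exists>a\<in>S. a \<in> C))"

context forcing_notion
begin

text \<open>
  A sequence \<open>\<langle>b\<^sub>n : n < \<omega>\<rangle>\<close> of subsets of \<open>X\<close> in the extension is given by a name \<open>b\<close> for a
  subset of \<open>\<omega> \<times> X\<close>.
\<close>

definition f_club :: "'a set \<Rightarrow> (('a \<times> 'p) set \<times> 'p) set \<Rightarrow> 'p \<Rightarrow> bool" where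
  "f_club X C =
     (f_all (names X) (\<lambda>\<sigma>. f_mem_fam X \<sigma> C \<^bold>\<longrightarrow> f_countable X \<sigma>)
      \<^bold>\<and> f_all (names X) (\<lambda>\<sigma>. f_countable X \<sigma> \<^bold>\<longrightarrow>
            f_ex (names X) (\<lambda>\<tau>. f_mem_fam X \<tau> C \<^bold>\<and> f_subset X \<sigma> \<tau>))
      \<^bold>\<and> f_all (names ((UNIV :: nat set) \<times> X)) (\<lambda>b.
            f_all UNIV (\<lambda>n. f_mem_fam X {(x, s). ((n, x), s) \<in> b} C
                \<^bold>\<and> f_subset X {(x, s). ((n, x), s) \<in> b} {(x, s). ((Suc n, x), s) \<in> b})
            \<^bold>\<longrightarrow> f_mem_fam X {(x, s). \<exists>n. ((n, x), s) \<in> b} C))"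

definition f_stationary :: "'a set \<Rightarrow> 'a set set \<Rightarrow> 'p \<Rightarrow> bool" where
  "f_stationary X S =
     f_all (Pow (names X \<times> P)) (\<lambda>C. f_club X C \<^bold>\<longrightarrow> f_ex S (\<lambda>a. f_mem_fam X (check a) C))"

text \<open>
  Properness: for every uncountable \<open>X\<close>, every stationary family of countable subsets of \<open>X\<close>
  remains stationary in the extension. Only the cardinality of \<open>X\<close> matters, so letting \<open>X\<close> range
  over sets of elements of \<^typ>\<open>'p set\<close> covers all cardinalities up to \<open>2\<^bsup>|P|\<^esup>\<close>; it is well known
  that this already implies the same for every \<open>X\<close> (the \<open>(N, P)\<close>-genericity of a
  condition depends only on the trace of \<open>N\<close> on \<open>P \<union> Pow P\<close>).
\<close>

definition proper :: bool where
  "proper \<longleftrightarrow>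
     (\<forall>(X :: 'p set set) S. uncountable X \<longrightarrow> stationary X S \<longrightarrow> forced (f_stationary X S))"

end


section \<open>Creatures\<close>

text \<open>
  Hereditarily countable sets: an element is determined by its countable set of elements, and
  the relation is well-founded.
\<close>

datatype hc = HC (elems: "hc cset")

definition hc_set :: "hc set \<Rightarrow> hc" where
  "hc_set A = HC (acset A)"

primrec hc_nat :: "nat \<Rightarrow> hc" where
  "hc_nat 0 = HC cempty"
| "hc_nat (Suc n) = HC (cinsert (hc_nat n) (elems (hc_nat n)))"

definition hc_pair :: "hc \<Rightarrow> hc \<Rightarrow> hc" where
  "hc_pair x y = hc_set {hc_set {x}, hc_set {x, y}}"

text \<open>
  Elements of \<open>\<Prod>\<^bsub>i<m\<^esub> H i\<close> are lists of length \<open>m\<close>, so that \<open>u\<close> is extended by \<open>v\<close> iff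
  \<^term>\<open>prefix u v\<close>, and \<open>v \<restriction> m\<close> is \<^term>\<open>take m v\<close>.
\<close>

definition seqs :: "(nat \<Rightarrow> 'a set) \<Rightarrow> nat \<Rightarrow> 'a list set" where
  "seqs H m = {u. length u = m \<and> (\<forall>i<m. u ! i \<in> H i)}"

datatype 'a creature =
  Creature (nor: real) (val: "('a list \<times> 'a list) set") (dis: hc)

text \<open>These are only meaningful when \<open>val t\<close> is as in the definition of \<open>CR\<close> below.\<close>

definition m_dn :: "'a creature \<Rightarrow> nat" where
  "m_dn t = (THE m. \<exists>(u, v)\<in>val t. length u = m)"

definition m_up :: "'a creature \<Rightarrow> nat" where
  "m_up t = (THE m. \<exists>(u, v)\<in>val t. length v = m)"

definition CR :: "(nat \<Rightarrow> 'a set) \<Rightarrow> 'a creature set" where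
  "CR H = {t. 0 \<le> nor t \<and> val t \<noteq> {} \<and>
     (\<exists>k l. k < l \<and> val t \<subseteq> {(u, v). u \<in> seqs H k \<and> v \<in> seqs H l \<and> prefix u v})}"

definition good_creating_pair ::
    "(nat \<Rightarrow> 'a set) \<Rightarrow> 'a creature set \<Rightarrow> ('a creature \<Rightarrow> 'a creature set) \<Rightarrow> bool" where
  "good_creating_pair H K \<Sigma> \<longleftrightarrow>
     (\<forall>m. finite (H m) \<and> 2 \<le> card (H m)) \<and> K \<subseteq> CR H \<and> (\<forall>t\<in>K. \<Sigma> t \<subseteq> K)
     \<and> (\<forall>t\<in>K. Domain (val t) = seqs H (m_dn t)
          \<and> t \<in> \<Sigma> t \<and> (\<forall>s\<in>\<Sigma> t. val s \<subseteq> val t)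
          \<and> (\<forall>s\<in>\<Sigma> t. \<Sigma> s \<subseteq> \<Sigma> t))"

definition local_pair :: "'a creature set \<Rightarrow> bool" where
  "local_pair K \<longleftrightarrow> (\<forall>t\<in>K. m_up t = m_dn t + 1)"

definition strongly_finitary :: "(nat \<Rightarrow> 'a set) \<Rightarrow> 'a creature set \<Rightarrow> bool" where
  "strongly_finitary H K \<longleftrightarrow> (\<forall>i. finite (H i) \<and> finite {t \<in> K. m_dn t = i})"

definition forgetful_creature :: "(nat \<Rightarrow> 'a set) \<Rightarrow> 'a creature \<Rightarrow> bool" where
  "forgetful_creature H t \<longleftrightarrow>
     (\<forall>v\<in>seqs H (m_up t). \<forall>u\<in>seqs H (m_dn t).
        (take (m_dn t) v, v) \<in> val t \<longrightarrow> (u, u @ drop (m_dn t) v) \<in> val t)"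

text \<open>``\<open>pos(t) = A\<close>'' for a local forgetful creature \<open>t\<close>.\<close>

definition has_pos :: "(nat \<Rightarrow> 'a set) \<Rightarrow> 'a creature \<Rightarrow> 'a set \<Rightarrow> bool" where
  "has_pos H t A \<longleftrightarrow> val t = {(u, u @ [a]) | u a. u \<in> seqs H (m_dn t) \<and> a \<in> A}"

text \<open>
  \<open>poss H w t n\<close> is \<open>pos(w, t\<^sub>0, \<dots>, t\<^bsub>n-1\<^esub>)\<close>, which is \<open>{w}\<close> for \<open>n = 0\<close>.
\<close>

definition poss ::
    "(nat \<Rightarrow> 'a set) \<Rightarrow> 'a list \<Rightarrow> (nat \<Rightarrow> 'a creature) \<Rightarrow> nat \<Rightarrow> 'a list set" where
  "poss H w t n = (if n = 0 then {w} else
     {v \<in> seqs H (m_up (t (n - 1))). prefix w v \<and>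
        (\<forall>i<n. (take (m_dn (t i)) v, take (m_up (t i)) v) \<in> val (t i))})"

definition Q_inf ::
    "(nat \<Rightarrow> 'a set) \<Rightarrow> 'a creature set \<Rightarrow> ('a list \<times> (nat \<Rightarrow> 'a creature)) set" where
  "Q_inf H K = {(w, t).
     (\<forall>i. t i \<in> K \<and> m_up (t i) = m_dn (t (Suc i))) \<and> w \<in> seqs H (m_dn (t 0))
     \<and> filterlim (\<lambda>n. nor (t n)) at_top sequentially}"

definition Q_inf_le ::
    "(nat \<Rightarrow> 'a set) \<Rightarrow> ('a creature \<Rightarrow> 'a creature set)
     \<Rightarrow> 'a list \<times> (nat \<Rightarrow> 'a creature) \<Rightarrow> 'a list \<times> (nat \<Rightarrow> 'a creature) \<Rightarrow> bool" where
  "Q_inf_le H \<Sigma> = (\<lambda>(w, t) (w', t').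
     \<exists>i. w' \<in> poss H w t i \<and> (\<forall>n. t' n \<in> \<Sigma> (t (n + i))))"


section \<open>The particular forcing notions\<close>

definition initial_segments :: "(nat \<Rightarrow> nat) \<Rightarrow> nat \<Rightarrow> nat set" where
  "initial_segments H i = {..<H i}"

definition dis_code :: "nat \<Rightarrow> nat set \<Rightarrow> hc" where
  "dis_code i A = hc_pair (hc_nat i) (hc_set (hc_nat ` A))"

definition K_g :: "(nat \<Rightarrow> nat) \<Rightarrow> (real \<Rightarrow> real) \<Rightarrow> nat creature set" where
  "K_g H g = {t \<in> CR (initial_segments H). forgetful_creature (initial_segments H) t \<and>
     (\<exists>i A. A \<noteq> {} \<and> A \<subseteq> initial_segments H i \<and> dis t = dis_code i A
        \<and> nor t = g (real (card A)) \<and> m_dn t = i \<and> m_up t = i + 1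
        \<and> has_pos (initial_segments H) t A)}"

definition Sigma_g :: "(nat \<Rightarrow> nat) \<Rightarrow> (real \<Rightarrow> real) \<Rightarrow> nat creature \<Rightarrow> nat creature set" where
  "Sigma_g H g t = {s \<in> K_g H g.
     \<exists>i A B. dis t = dis_code i A \<and> dis s = dis_code i B \<and> B \<subseteq> A}"

definition Q_sets :: "(nat \<Rightarrow> nat set) set" where
  "Q_sets = {w. (\<forall>n. w n \<subseteq> {..<2 ^ n} \<and> w n \<noteq> {})
     \<and> filterlim (\<lambda>n. card (w n)) at_top sequentially}"

definition Q_sets_le :: "(nat \<Rightarrow> nat set) \<Rightarrow> (nat \<Rightarrow> nat set) \<Rightarrow> bool" where
  "Q_sets_le w w' \<longleftrightarrow> (\<forall>n. w' n \<subseteq> w n)"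

end

(*
  A condition of either forcing notion is a box, i.e. a sequence of finite sets A i of sizes
  tending to infinity. The key is to code a ground model real x into the generic real W so that
  the decoding procedure starts from finite information: fix a maximal antichain M of thin
  boxes r (r i is very small compared with i). Below r in M the coordinates are grouped into
  consecutive blocks, and each block carries a residue, the number of its coordinates i such that
  the index of W i in r i lies in a certain set V. For every sub-box s of r there is, by the
  pigeonhole principle, one V that halves s i for very many i in the block, so every residue can be
  forced by passing to a sub-box of half the size. The residue of a block encodes one bit of x
  together with the set V to be used in the next block. Hence each box can be shrunk so that it
  decides the decoded real to be x, and only the choice of the first block and its V, a natural
  number, is left undetermined: the real decoded from n, for n a natural number, lists all ground
  model reals.
*)
theory Submission
  imports Defs "HOL-Library.Nat_Bijection" "HOL-Library.FuncSet"
begin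

section \<open>Forcing that a set is countable\<close>

context forcing_notion
begin

lemma f_mem_name:
  assumes "(x, s) \<in> \<sigma>" "s \<in> P"
  shows "f_mem x \<sigma> s"
  using assms le_refl unfolding f_mem_def by blast

text \<open>\<open>E n x\<close> plays the part of the conditions deciding that the natural number
  \<open>n\<close> decodes to \<open>x\<close>. Incompatibility makes decoding a partial function of
  \<open>n\<close> in the extension, density makes it onto \<open>X\<close>, and inverting it gives
  the injection that \<open>f_countable\<close> asks for.\<close>

lemma forced_f_countable:
  fixes E :: "nat \<Rightarrow> 'a \<Rightarrow> 'p set"
  assumes sub: "\<And>n x. x \<in> X \<Longrightarrow> E n x \<subseteq> P"
    and incompat: "\<And>n x y s t q. \<lbrakk>x \<in> X; y \<in> X; s \<in> E n x; t \<in> E n y; q \<in> P; le s q; le t q\<rbrakk> \<Longrightarrow> x = y"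
    and dense: "\<And>p x. \<lbrakk>p \<in> P; x \<in> X\<rbrakk> \<Longrightarrow> \<exists>n. \<exists>q\<in>E n x. le p q"
  shows "forced (f_countable X (check X))"
proof -
  \<comment> \<open>\<open>E n x\<close> is not assumed closed under extension; the upward closure
    \<open>U n x\<close> supplies the persistence used below.\<close>
  define U where "U n x = {q \<in> P. \<exists>s\<in>E n x. le s q}" for n x
  have U_up: "r \<in> U n x" if "s \<in> U n x" "le s r" "r \<in> P" "x \<in> X" for n x s r
  proof -
    from that obtain t where "t \<in> E n x" "le t s" "s \<in> P"
      unfolding U_def by blast
    with that sub[of x n] le_trans[of t s r] show ?thesis
      unfolding U_def by blast
  qed
  have U_eq: "x = y" if "r \<in> U n x" "r \<in> U n y" "x \<in> X" "y \<in> X" for n x y r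
  proof -
    from \<open>r \<in> U n x\<close> obtain s where "s \<in> E n x" "le s r" "r \<in> P"
      unfolding U_def by blast
    moreover from \<open>r \<in> U n y\<close> obtain t where "t \<in> E n y" "le t r"
      unfolding U_def by blast
    ultimately show ?thesis
      using incompat that(3,4) by blast
  qed
  \<comment> \<open>Taking the least \<open>n\<close> that decides \<open>x\<close> makes this a name for a function.\<close>
  define f where
    "f = {((x, n), s) | x n s. x \<in> X \<and> s \<in> U n x \<and> (\<forall>m<n. \<forall>q\<in>P. le s q \<longrightarrow> q \<notin> U m x)}"
  have f_names: "f \<in> names (X \<times> UNIV)"
    unfolding names_def f_def U_def by auto
  have f_dense: "\<exists>r\<in>P. le q r \<and> (\<exists>n. ((x, n), r) \<in> f)" if q: "q \<in> P" and x: "x \<in> X" for q x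
  proof -
    let ?Q = "\<lambda>n. \<exists>r\<in>U n x. le q r"
    obtain n r where "r \<in> E n x" "le q r"
      using dense[OF q x] by blast
    then have "r \<in> U n x"
      using sub[OF x] le_refl[of r] unfolding U_def by blast
    with \<open>le q r\<close> have "\<exists>n. ?Q n"
      by blast
    then obtain n where n: "?Q n" and least: "\<And>m. m < n \<Longrightarrow> \<not> ?Q m"
      using exists_least_iff[of ?Q] by blast
    from n obtain r where r: "r \<in> U n x" "le q r" by blast
    then have "r \<in> P" by (simp add: U_def)
    moreover have "((x, n), r) \<in> f"
      unfolding f_def mem_Collect_eq
      using x r least le_trans[OF q \<open>r \<in> P\<close>] by blast
    ultimately show ?thesis using r by blast
  qed
  \<comment> \<open>Forced membership yields witnesses only densely, so \<open>q\<close> is extended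
    twice, to an \<open>r\<close> above witnesses of both memberships.\<close>
  have common: "\<exists>r s s'. r \<in> P \<and> ((x, m), s) \<in> f \<and> ((y, n), s') \<in> f \<and> le s r \<and> le s' r"
    if "f_mem (x, m) f q" "f_mem (y, n) f q" "q \<in> P" for x y m n q
  proof -
    obtain r s where r: "r \<in> P" "le q r" "s \<in> P" "((x, m), s) \<in> f" "le s r"
      using \<open>f_mem (x, m) f q\<close> le_refl[OF \<open>q \<in> P\<close>] \<open>q \<in> P\<close> unfolding f_mem_def by blast
    obtain r' s' where r': "r' \<in> P" "le r r'" "s' \<in> P" "((y, n), s') \<in> f" "le s' r'"
      using \<open>f_mem (y, n) f q\<close> r(1,2) unfolding f_mem_def by blast
    have "le s r'"
      using r r' le_trans[of s r r'] by blast
    with r r' show ?thesis by blast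
  qed
  have functional: "m = n" if asm: "f_mem (x, m) f q" "f_mem (x, n) f q" "q \<in> P" for x m n q
  proof -
    obtain r s s' where *: "r \<in> P" "((x, m), s) \<in> f" "((x, n), s') \<in> f" "le s r" "le s' r"
      using common[OF asm] by blast
    have "x \<in> X" "s \<in> U m x" "s' \<in> U n x"
      and "\<forall>k<m. \<forall>q\<in>P. le s q \<longrightarrow> q \<notin> U k x" "\<forall>k<n. \<forall>q\<in>P. le s' q \<longrightarrow> q \<notin> U k x"
      using *(2,3) unfolding f_def by blast+
    \<comment> \<open>\<open>r\<close> lies in both \<open>U m x\<close> and \<open>U n x\<close>,
      so if \<open>m\<close> and \<open>n\<close> differed, the larger one would violate the
      minimality recorded in \<open>f\<close>.\<close>
    then show ?thesis
      using U_up[of s m x r] U_up[of s' n x r] *(1,4,5) by (meson linorder_neqE_nat)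
  qed
  have injective: "x = y" if asm: "f_mem (x, n) f q" "f_mem (y, n) f q" "q \<in> P" for x y n q
  proof -
    obtain r s s' where *: "r \<in> P" "((x, n), s) \<in> f" "((y, n), s') \<in> f" "le s r" "le s' r"
      using common[OF asm] by blast
    have "x \<in> X" "s \<in> U n x" "y \<in> X" "s' \<in> U n y"
      using *(2,3) unfolding f_def by blast+
    then show ?thesis
      using U_eq[of r n x y] U_up[of s n x r] U_up[of s' n y r] *(1,4,5) by blast
  qed
  have total: "f_ex UNIV (\<lambda>n. f_mem (x, n) f) q" if "q \<in> P" "x \<in> X" for x q
    unfolding f_ex_def
  proof (intro ballI impI)
    fix r
    assume "r \<in> P"
    then obtain r' n where "r' \<in> P" "le r r'" "((x, n), r') \<in> f"
      using f_dense \<open>x \<in> X\<close> by blast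
    moreover from this have "f_mem (x, n) f r'"
      by (intro f_mem_name)
    ultimately show "\<exists>r'\<in>P. le r r' \<and> (\<exists>n\<in>UNIV. f_mem (x, n) f r')"
      by blast
  qed
  have 1: "f_all X (\<lambda>x. f_mem x (check X) \<^bold>\<longrightarrow> f_ex UNIV (\<lambda>n. f_mem (x, n) f)) q" for q
    unfolding f_all_def f_imp_def using total by blast
  have 2: "f_all X (\<lambda>x. f_all UNIV (\<lambda>m. f_all UNIV (\<lambda>n.
             f_mem (x, m) f \<^bold>\<and> f_mem (x, n) f \<^bold>\<longrightarrow> f_gnd (m = n)))) q" for q
    unfolding f_all_def f_imp_def f_and_def f_gnd_def using functional by blast
  have 3: "f_all X (\<lambda>x. f_all X (\<lambda>y. f_all UNIV (\<lambda>n.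
             f_mem (x, n) f \<^bold>\<and> f_mem (y, n) f \<^bold>\<longrightarrow> f_gnd (x = y)))) q" for q
    unfolding f_all_def f_imp_def f_and_def f_gnd_def using injective by blast
  have "f_ex (names (X \<times> UNIV)) \<phi> p" if "p \<in> P" "\<And>q. \<phi> f q" for \<phi> p
    unfolding f_ex_def using that f_names le_refl by blast
  then show ?thesis
    unfolding forced_def f_countable_def
    using 1 2 3 by (simp add: f_and_def)
qed

section \<open>Ground model sets in the extension, and failure of properness\<close>

lemma f_mem_check_iff:
  assumes "p \<in> P"
  shows "f_mem x (check A) p \<longleftrightarrow> x \<in> A"
proof
  assume "f_mem x (check A) p"
  then show "x \<in> A"
    using assms le_refl[OF assms] unfolding f_mem_def check_def mem_Sigma_iff by blast
next
  assume "x \<in> A"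
  then show "f_mem x (check A) p"
    using le_refl unfolding f_mem_def check_def mem_Sigma_iff by blast
qed

lemma f_all_check_imp:
  "f_all X (\<lambda>x. f_mem x (check X) \<^bold>\<longrightarrow> \<phi> x) p \<Longrightarrow> f_all X (\<lambda>x. f_mem x \<sigma> \<^bold>\<longrightarrow> \<phi> x) p"
  unfolding f_all_def f_imp_def by (simp add: f_mem_check_iff)

lemma f_ex_mono: "(\<And>i q. \<phi> i q \<Longrightarrow> \<psi> i q) \<Longrightarrow> f_ex I \<phi> p \<Longrightarrow> f_ex I \<psi> p"
  unfolding f_ex_def by metis

text \<open>An injection defined on all of \<open>X\<close> covers every named subset:
  \<open>\<sigma>\<close> enters only the totality clause, as a hypothesis that is weakest for
  \<open>check X\<close>.\<close>

lemma f_countable_check_imp: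
  "f_countable X (check X) p \<Longrightarrow> f_countable X \<sigma> p"
  unfolding f_countable_def f_and_def
  by (erule f_ex_mono[rotated]) (auto intro: f_all_check_imp)

text \<open>Forced membership is persistent, so the quantifier over stronger conditions hidden in
  the implication disappears.\<close>

lemma f_subset_check_iff:
  assumes "p \<in> P" "A \<subseteq> X"
  shows "f_subset X (check A) \<sigma> p \<longleftrightarrow> (\<forall>x\<in>A. f_mem x \<sigma> p)"
proof -
  have mono: "f_mem x \<sigma> q" if "f_mem x \<sigma> p" "q \<in> P" "le p q" for x q
    unfolding f_mem_def
  proof (intro ballI impI)
    fix r
    assume "r \<in> P" "le q r"
    then have "le p r"
      using le_trans[of p q r] assms that by blast
    with that(1) \<open>r \<in> P\<close> show "\<exists>r'\<in>P. le r r' \<and> (\<exists>s\<in>P. (x, s) \<in> \<sigma> \<and> le s r')"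
      unfolding f_mem_def by blast
  qed
  have "f_subset X (check A) \<sigma> p \<longleftrightarrow> (\<forall>x\<in>X. \<forall>q\<in>P. le p q \<longrightarrow> x \<in> A \<longrightarrow> f_mem x \<sigma> q)"
    unfolding f_subset_def f_all_def f_imp_def by (simp add: f_mem_check_iff)
  also have "\<dots> \<longleftrightarrow> (\<forall>x\<in>A. f_mem x \<sigma> p)"
    using \<open>A \<subseteq> X\<close> mono le_refl[OF \<open>p \<in> P\<close>] \<open>p \<in> P\<close> by (meson subset_iff)
  finally show ?thesis .
qed

lemma f_subset_of_check: "p \<in> P \<Longrightarrow> f_subset X \<sigma> (check X) p"
  unfolding f_subset_def f_all_def f_imp_def by (simp add: f_mem_check_iff)

text \<open>\<open>{check X} \<times> P\<close> names the family whose only element is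
  \<open>X\<close>; belonging to it means exhausting \<open>X\<close>, which has to be forced only
  densely.\<close>

lemma f_mem_fam_check_iff:
  "f_mem_fam X \<sigma> ({check X} \<times> P) p \<longleftrightarrow>
     (\<forall>q\<in>P. le p q \<longrightarrow> (\<exists>r\<in>P. le q r \<and> (\<forall>x\<in>X. f_mem x \<sigma> r)))"
proof -
  have "(\<exists>\<tau>. \<exists>s\<in>P. (\<tau>, s) \<in> {check X} \<times> P \<and> le s r \<and> f_eq X \<sigma> \<tau> r) \<longleftrightarrow> (\<forall>x\<in>X. f_mem x \<sigma> r)"
    if r: "r \<in> P" for r
  proof -
    have "f_eq X \<sigma> (check X) r \<longleftrightarrow> (\<forall>x\<in>X. f_mem x \<sigma> r)"
      unfolding f_eq_def f_and_def f_subset_check_iff[OF r subset_refl]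
      by (simp add: f_subset_of_check[OF r])
    then show ?thesis
      using r le_refl[OF r] by auto
  qed
  then show ?thesis
    unfolding f_mem_fam_def by simp
qed

text \<open>
  The one-element family of the collapsed set itself is club in the extension, and it contains no
  countable set of the ground model.
\<close>

lemma not_proper_if_collapses_uncountable:
  fixes X :: "'p set set"
  assumes "uncountable X" and collapse: "forced (f_countable X (check X))"
  shows "\<not> proper"
proof
  assume "proper"
  define S where "S = {a. a \<subseteq> X \<and> countable a}"
  define C where "C = {check X} \<times> P"
  have "stationary X S"
    unfolding stationary_def
  proof (intro conjI allI impI)
    show "\<forall>a\<in>S. a \<subseteq> X \<and> countable a"
      unfolding S_def by blast
    fix C
    assume "club X C"
    then have "\<forall>a\<in>C. a \<in> S" and "\<exists>b\<in>C. {} \<subseteq> b"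
      unfolding club_def S_def by (blast, metis countable_empty empty_subsetI)
    then show "\<exists>a\<in>S. a \<in> C"
      by blast
  qed
  with \<open>proper\<close> \<open>uncountable X\<close> have "forced (f_stationary X S)"
    unfolding proper_def by blast
  moreover obtain p where p: "p \<in> P"
    using nonempty by blast
  moreover have "check X \<in> names X"
    unfolding check_def names_def by blast
  then have "C \<in> Pow (names X \<times> P)"
    unfolding C_def by blast
  moreover have "f_club X C p"
  proof -
    \<comment> \<open>The collapse makes \<open>X\<close> countable in the extension, hence also
      each of its subsets.\<close>
    have 1: "f_all (names X) (\<lambda>\<sigma>. f_mem_fam X \<sigma> C \<^bold>\<longrightarrow> f_countable X \<sigma>) p"
      using collapse f_countable_check_imp unfolding f_all_def f_imp_def forced_def by blast
    have "f_mem_fam X (check X) C q \<and> f_subset X \<sigma> (check X) q" if "q \<in> P" for q \<sigma>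
      unfolding C_def f_mem_fam_check_iff
      using f_subset_of_check[OF that] le_refl by (auto simp: f_mem_check_iff)
    then have 2: "f_all (names X) (\<lambda>\<sigma>. f_countable X \<sigma> \<^bold>\<longrightarrow>
        f_ex (names X) (\<lambda>\<tau>. f_mem_fam X \<tau> C \<^bold>\<and> f_subset X \<sigma> \<tau>)) p"
      using \<open>check X \<in> names X\<close> le_refl unfolding f_all_def f_imp_def f_ex_def f_and_def by blast
    \<comment> \<open>Closure under unions of chains: if the first member already is all of
      \<open>X\<close>, then so is the union.\<close>
    have "f_mem_fam X {(x, s). \<exists>n. ((n, x), s) \<in> b} C q"
      if "f_mem_fam X {(x, s). ((0, x), s) \<in> b} C q" for b :: "((nat \<times> 'p set) \<times> 'p) set" and q
    proof -
      have "f_mem x {(x, s). \<exists>n. ((n, x), s) \<in> b} r" if "f_mem x {(x, s). ((0, x), s) \<in> b} r" for x r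
        using that unfolding f_mem_def by blast
      with that show ?thesis
        unfolding C_def f_mem_fam_check_iff by blast
    qed
    then have 3: "f_all (names ((UNIV :: nat set) \<times> X)) (\<lambda>b.
            f_all UNIV (\<lambda>n. f_mem_fam X {(x, s). ((n, x), s) \<in> b} C
                \<^bold>\<and> f_subset X {(x, s). ((n, x), s) \<in> b} {(x, s). ((Suc n, x), s) \<in> b})
            \<^bold>\<longrightarrow> f_mem_fam X {(x, s). \<exists>n. ((n, x), s) \<in> b} C) p"
      unfolding f_all_def f_imp_def f_and_def by blast
    from 1 2 3 show ?thesis
      unfolding f_club_def f_and_def by blast
  qed
  ultimately have "f_ex S (\<lambda>a. f_mem_fam X (check a) C) p"
    using le_refl unfolding forced_def f_stationary_def f_all_def f_imp_def by blast
  then obtain r a where "r \<in> P" "a \<in> S" "f_mem_fam X (check a) C r"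
    using p le_refl unfolding f_ex_def by blast
  then have "X \<subseteq> a"
    using le_refl unfolding C_def f_mem_fam_check_iff by (auto simp: f_mem_check_iff)
  with \<open>a \<in> S\<close> \<open>uncountable X\<close> show False
    unfolding S_def using countable_subset by blast
qed

end

section \<open>Coding a real into a box\<close>

text \<open>Choose in each coordinate half of the image of \<open>S i\<close>; by pigeonhole one set
  \<open>V\<close> is the chosen half for at least \<open>m\<close> coordinates. There both sides of
  \<open>V\<close> are large enough, so it is free which side to keep, and every residue modulo
  \<open>m\<close> can be reached. It is essential for the later coding that \<open>V\<close> is
  chosen before the residue \<open>c\<close>.\<close>

lemma block_coding:
  fixes f :: "'i \<Rightarrow> 'a \<Rightarrow> nat" and S :: "'i \<Rightarrow> 'a set"
  assumes I: "finite I" "2 ^ N * m \<le> card I"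
    and inj: "\<And>i. i \<in> I \<Longrightarrow> inj_on (f i) (S i)"
    and bounded: "\<And>i. i \<in> I \<Longrightarrow> f i ` S i \<subseteq> {..<N}"
  shows "\<exists>V\<subseteq>{..<N}. \<forall>c<m. \<exists>B. (\<forall>i\<in>I. B i \<subseteq> S i \<and> card (S i) div 2 \<le> card (B i)) \<and>
           (\<forall>W. (\<forall>i\<in>I. W i \<in> B i) \<longrightarrow> card {i \<in> I. f i (W i) \<in> V} mod m = c)"
proof -
  have fin: "finite (S i)" if "i \<in> I" for i
    using finite_imageD[OF finite_subset[OF bounded[OF that]] inj[OF that]] by simp
  have "\<exists>V \<subseteq> f i ` S i. card V = card (S i) div 2" if "i \<in> I" for i
    using obtain_subset_with_card_n[of "card (S i) div 2" "f i ` S i"] card_image[OF inj[OF that]]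
    by (metis div_le_dividend)
  then obtain half where half: "\<And>i. i \<in> I \<Longrightarrow> half i \<subseteq> f i ` S i"
      "\<And>i. i \<in> I \<Longrightarrow> card (half i) = card (S i) div 2"
    by metis
  have "half \<in> I \<rightarrow> Pow {..<N}"
    using half bounded by blast
  then obtain V where V: "V \<subseteq> {..<N}" "card I \<le> card (half -` {V} \<inter> I) * card (Pow {..<N})"
    using pigeonhole_card[of half I "Pow {..<N}"] \<open>finite I\<close> by auto
  define G where "G = half -` {V} \<inter> I"
  have "m \<le> card G"
    using V(2) I(2) unfolding G_def[symmetric]
    by (metis (no_types, lifting) card_Pow card_lessThan finite_lessThan le_trans mult.commute
        mult_le_cancel2 zero_less_numeral zero_less_power)
  define inside where "inside i = {a \<in> S i. f i a \<in> V}" for i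
  define outside where "outside i = {a \<in> S i. f i a \<notin> V}" for i
  have split: "card (inside i) + card (outside i) = card (S i)" if "i \<in> I" for i
  proof -
    have "S i = inside i \<union> outside i" "inside i \<inter> outside i = {}"
      unfolding inside_def outside_def by blast+
    then show ?thesis
      using fin[OF that] by (metis card_Un_disjoint finite_Un)
  qed
  have inside_half: "card (inside i) = card (S i) div 2" if "i \<in> G" for i
  proof -
    have i: "i \<in> I" "half i = V" using that unfolding G_def by auto
    have "f i ` inside i = V"
      using half(1)[OF i(1)] i(2) unfolding inside_def by blast
    moreover have "inj_on (f i) (inside i)"
      using inj[OF i(1)] unfolding inside_def by (simp add: inj_on_def)
    ultimately show ?thesis
      using half(2)[OF i(1)] i(2) card_image by metis
  qed
  \<comment> \<open>Off \<open>G\<close> there is no freedom: a large enough side is kept, and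
    \<open>D\<close> collects the coordinates where this is the inner side.\<close>
  define D where "D = {i \<in> I - G. card (S i) div 2 \<le> card (inside i)}"
  have "\<exists>B. (\<forall>i\<in>I. B i \<subseteq> S i \<and> card (S i) div 2 \<le> card (B i)) \<and>
           (\<forall>W. (\<forall>i\<in>I. W i \<in> B i) \<longrightarrow> card {i \<in> I. f i (W i) \<in> V} mod m = c)"
    if "c < m" for c
  proof -
    \<comment> \<open>\<open>e\<close> is the number of coordinates of \<open>G\<close> to be sent
      inside, namely \<open>c - card D\<close> modulo \<open>m\<close>. Reducing
      \<open>card D\<close> first keeps the natural subtraction from truncating.\<close>
    define e where "e = (c + (m - card D mod m)) mod m"
    have "(card D + e) mod m = (card D mod m + (c + (m - card D mod m))) mod m"
      unfolding e_def by (metis mod_add_eq mod_mod_trivial)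
    also have "card D mod m + (c + (m - card D mod m)) = c + m"
      using \<open>c < m\<close> mod_less_divisor[of m "card D"] by linarith
    also have "(c + m) mod m = c"
      using \<open>c < m\<close> by simp
    finally have e: "(card D + e) mod m = c" .
    have "e \<le> card G"
      using \<open>m \<le> card G\<close> \<open>c < m\<close> mod_less_divisor[of m] unfolding e_def
      by (metis bot_nat_0.not_eq_extremum less_imp_le_nat not_less_zero order_trans)
    then obtain G' where G': "G' \<subseteq> G" "card G' = e"
      using obtain_subset_with_card_n by metis
    define B where "B i = (if i \<in> D \<union> G' then inside i else outside i)" for i
    have "B i \<subseteq> S i \<and> card (S i) div 2 \<le> card (B i)" if "i \<in> I" for i
    proof (cases "i \<in> G")
      case True
      then show ?thesis
        using inside_half[OF True] split[OF that] unfolding B_def inside_def outside_def by auto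
    next
      case False
      then show ?thesis
        using split[OF that] that G' unfolding B_def inside_def outside_def D_def by auto
    qed
    moreover have "card {i \<in> I. f i (W i) \<in> V} mod m = c" if "\<forall>i\<in>I. W i \<in> B i" for W
    proof -
      have "{i \<in> I. f i (W i) \<in> V} = D \<union> G'"
        using that G' unfolding B_def inside_def outside_def D_def G_def by (auto split: if_splits)
      moreover have "card (D \<union> G') = card D + e"
        using G' finite_subset[of _ I] \<open>finite I\<close> unfolding D_def G_def
        by (subst card_Un_disjoint) auto
      ultimately show ?thesis using e by simp
    qed
    ultimately show ?thesis by blast
  qed
  with V(1) show ?thesis by blast
qed

section \<open>Boxes and the division of the coordinates into blocks\<close>

lemma filterlim_nat_at_top:
  fixes c :: "nat \<Rightarrow> nat"
  shows "filterlim c at_top sequentially \<longleftrightarrow> (\<forall>k. \<exists>n. \<forall>i\<ge>n. k \<le> c i)"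
  by (simp add: filterlim_at_top eventually_sequentially)

definition boxes :: "(nat \<Rightarrow> nat) \<Rightarrow> (nat \<Rightarrow> nat set) set" where
  "boxes H = {A. (\<forall>i. A i \<subseteq> {..<H i} \<and> A i \<noteq> {}) \<and> filterlim (\<lambda>i. card (A i)) at_top sequentially}"

lemma Q_sets_eq_boxes: "Q_sets = boxes (\<lambda>n. 2 ^ n)"
  unfolding Q_sets_def boxes_def by simp

lemma Q_sets_le_refl: "Q_sets_le p p"
  unfolding Q_sets_le_def by blast

lemma Q_sets_le_trans: "Q_sets_le p q \<Longrightarrow> Q_sets_le q r \<Longrightarrow> Q_sets_le p r"
  unfolding Q_sets_le_def by blast

lemma boxes_nonempty: "A \<in> boxes H \<Longrightarrow> A i \<noteq> {}"
  unfolding boxes_def by blast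

lemma boxes_finite: "A \<in> boxes H \<Longrightarrow> finite (A i)"
  unfolding boxes_def using finite_subset by blast

lemma boxes_large: "A \<in> boxes H \<Longrightarrow> \<exists>n. \<forall>i\<ge>n. k \<le> card (A i)"
  unfolding boxes_def filterlim_nat_at_top by blast

lemma boxes_subI:
  assumes "A \<in> boxes H" "\<And>i. B i \<subseteq> A i" "\<And>i. B i \<noteq> {}"
    "\<And>k. \<exists>n. \<forall>i\<ge>n. k \<le> card (B i)"
  shows "B \<in> boxes H"
  using assms unfolding boxes_def filterlim_nat_at_top by blast

text \<open>The growth rate 32 makes each block long enough for the pigeonhole argument. The blocks
  start at coordinate 1, so coordinate 0 lies in none of them.\<close>

definition block :: "nat \<Rightarrow> nat set" where
  "block j = {32 ^ j..<32 ^ Suc j}"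

lemma finite_block [simp]: "finite (block j)"
  unfolding block_def by simp

lemma block_ge: "i \<in> block j \<Longrightarrow> j \<le> i"
  unfolding block_def using power_gt_expt[of 32 j] by simp

lemma block_unique:
  assumes "i \<in> block j" "i \<in> block k"
  shows "j = k"
proof -
  have "j \<le> k" if "(32::nat) ^ j \<le> i" "i < 32 ^ Suc k" for j k
    using that power_less_imp_less_exp[of "32::nat" j "Suc k"] by linarith
  then show ?thesis
    using assms unfolding block_def by (auto intro!: antisym)
qed

lemma in_some_block:
  assumes "0 < i"
  shows "\<exists>j. i \<in> block j"
  using ex_power_ivl1[of 32 i] assms unfolding block_def by auto

text \<open>The first factor counts the subsets of \<open>{..<Suc j}\<close>, the candidates for
  \<open>V\<close>; the second is the modulus used for block \<open>j\<close>.\<close>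

lemma card_block: "2 ^ (j + 1) * 2 ^ (j + 3) \<le> card (block j)"
proof -
  have "(2::nat) ^ (j + 1) * 2 ^ (j + 3) = 16 * 4 ^ j"
    by (simp add: power_add power_mult_distrib[symmetric])
  also have "\<dots> \<le> 31 * 32 ^ j"
    by (intro mult_mono power_mono) auto
  also have "\<dots> = card (block j)"
    unfolding block_def by simp
  finally show ?thesis .
qed

section \<open>Thin boxes and a maximal antichain of them\<close>

text \<open>The bound puts all indices of points in block \<open>j\<close> below
  \<open>Suc j\<close>, so that few sets \<open>V\<close> compete compared with the length of the
  block.\<close>

definition thin :: "(nat \<Rightarrow> nat) \<Rightarrow> (nat \<Rightarrow> nat set) set" where
  "thin H = {r \<in> boxes H. \<forall>j. \<forall>i\<in>block j. card (r i) \<le> Suc j}"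

text \<open>Cutting \<open>p i\<close> down to at most \<open>Suc j\<close> points in block
  \<open>j\<close> keeps the sizes unbounded, because the block number tends to infinity with
  \<open>i\<close>.\<close>

lemma thin_dense:
  assumes "p \<in> boxes H"
  shows "\<exists>r\<in>thin H. Q_sets_le p r"
proof -
  \<comment> \<open>At coordinate 0 the value of \<open>v\<close> is unspecified; the successor in
    \<open>c\<close> still leaves at least one point there.\<close>
  define v where "v i = (THE j. i \<in> block j)" for i
  have v: "v i = j" if "i \<in> block j" for i j
    unfolding v_def using that block_unique[OF _ that] by (rule the_equality)
  define c where "c i = min (card (p i)) (Suc (v i))" for i
  have "\<exists>B \<subseteq> p i. card B = c i" for i
    using obtain_subset_with_card_n[of "c i" "p i"] unfolding c_def by auto
  then obtain r where r: "\<And>i. r i \<subseteq> p i" "\<And>i. card (r i) = c i"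
    by metis
  have "0 < c i" for i
    using boxes_nonempty[OF assms] boxes_finite[OF assms] unfolding c_def by (simp add: card_gt_0_iff)
  then have "r i \<noteq> {}" for i
    using r(2)[of i] by (metis card.empty less_irrefl)
  moreover have "\<exists>n. \<forall>i\<ge>n. k \<le> card (r i)" for k
  proof -
    obtain n where n: "\<forall>i\<ge>n. k \<le> card (p i)"
      using boxes_large[OF assms] by blast
    have "k \<le> card (r i)" if "i \<ge> max n (32 ^ k)" for i
    proof -
      have "0 < i"
        using that zero_less_power[of "32::nat" k] by linarith
      then obtain j where j: "i \<in> block j"
        using in_some_block by blast
      then have "(32::nat) ^ k < 32 ^ Suc j"
        using that unfolding block_def by auto
      then have "k < Suc j"
        by (rule power_less_imp_less_exp[rotated]) simp
      then show ?thesis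
        using n that v[OF j] unfolding r(2) c_def by simp
    qed
    then show ?thesis by blast
  qed
  ultimately have "r \<in> boxes H"
    using boxes_subI[OF assms r(1)] by blast
  moreover have "card (r i) \<le> Suc j" if "i \<in> block j" for i j
    using v[OF that] r(2) unfolding c_def by simp
  ultimately show ?thesis
    using r(1) unfolding thin_def Q_sets_le_def by blast
qed

definition compatible :: "(nat \<Rightarrow> nat) \<Rightarrow> (nat \<Rightarrow> nat set) \<Rightarrow> (nat \<Rightarrow> nat set) \<Rightarrow> bool" where
  "compatible H p q \<longleftrightarrow> (\<exists>r\<in>boxes H. Q_sets_le p r \<and> Q_sets_le q r)"

text \<open>Zorn's lemma. Maximality among thin boxes gives compatibility with every box by density:
  a thin extension of a box incompatible with all of \<open>M\<close> could be added to
  \<open>M\<close>. The antichain lets the generic object single out one reference box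
  \<open>r\<close> for decoding.\<close>

lemma thin_maximal_antichain:
  obtains M where "M \<subseteq> thin H"
    and "\<And>p q. \<lbrakk>p \<in> M; q \<in> M; compatible H p q\<rbrakk> \<Longrightarrow> p = q"
    and "\<And>p. p \<in> boxes H \<Longrightarrow> \<exists>r\<in>M. compatible H p r"
proof -
  define \<A> where "\<A> = {M. M \<subseteq> thin H \<and> (\<forall>p\<in>M. \<forall>q\<in>M. compatible H p q \<longrightarrow> p = q)}"
  have "\<Union>C \<in> \<A>" if C: "subset.chain \<A> C" for C
  proof -
    have "p = q" if "p \<in> \<Union>C" "q \<in> \<Union>C" "compatible H p q" for p q
    proof -
      obtain X Y where "X \<in> C" "p \<in> X" "Y \<in> C" "q \<in> Y" using \<open>p \<in> \<Union>C\<close> \<open>q \<in> \<Union>C\<close> by blast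
      moreover have "X \<subseteq> Y \<or> Y \<subseteq> X"
        using C \<open>X \<in> C\<close> \<open>Y \<in> C\<close> unfolding subset_chain_def by simp
      ultimately obtain Z where "Z \<in> C" "p \<in> Z" "q \<in> Z"
        by blast
      moreover from this have "Z \<in> \<A>"
        using C unfolding subset_chain_def by blast
      ultimately show ?thesis
        using \<open>compatible H p q\<close> unfolding \<A>_def by blast
    qed
    moreover have "\<Union>C \<subseteq> thin H"
      using C unfolding subset_chain_def \<A>_def by auto
    ultimately show ?thesis
      unfolding \<A>_def by blast
  qed
  then obtain M where M: "M \<in> \<A>" and max: "\<And>X. X \<in> \<A> \<Longrightarrow> M \<subseteq> X \<Longrightarrow> X = M"
    using subset_Zorn'[of \<A>] by auto
  have "\<exists>r\<in>M. compatible H p r" if p: "p \<in> boxes H" for p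
  proof (rule ccontr)
    assume none: "\<not> ?thesis"
    obtain d where d: "d \<in> thin H" "Q_sets_le p d"
      using thin_dense[OF p] by blast
    have comm: "compatible H a b \<longleftrightarrow> compatible H b a" for a b
      unfolding compatible_def by (simp add: conj_commute)
    have "\<not> compatible H d r" if "r \<in> M" for r
    proof
      assume "compatible H d r"
      then obtain s where "s \<in> boxes H" "Q_sets_le d s" "Q_sets_le r s"
        unfolding compatible_def by blast
      with Q_sets_le_trans[OF d(2)] have "compatible H p r"
        unfolding compatible_def by blast
      with none that show False by blast
    qed
    moreover from this have "\<not> compatible H r d" if "r \<in> M" for r
      using comm that by blast
    ultimately have "insert d M \<in> \<A>"
      using M d(1) unfolding \<A>_def by simp
    then have "d \<in> M"
      using max by blast
    moreover have "compatible H p d"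
      using d Q_sets_le_refl[of d] unfolding compatible_def thin_def by blast
    ultimately show False
      using none by blast
  qed
  moreover have "M \<subseteq> thin H" "\<And>p q. \<lbrakk>p \<in> M; q \<in> M; compatible H p q\<rbrakk> \<Longrightarrow> p = q"
    using M unfolding \<A>_def by auto
  ultimately show thesis
    using that by presburger
qed

section \<open>Decoding a real from a branch\<close>

text \<open>The enumeration is arbitrary but depends on the set alone, so the decoder can compute
  indices from the reference box \<open>r\<close>.\<close>

definition index :: "nat set \<Rightarrow> nat \<Rightarrow> nat" where
  "index A = (SOME h. bij_betw h A {0..<card A})"

lemma index_bij: "finite A \<Longrightarrow> bij_betw (index A) A {0..<card A}"
  unfolding index_def using ex_bij_betw_finite_nat by (rule someI_ex)

text \<open>A state is a binary code: bit \<open>n + 1\<close> tells whether index \<open>n\<close>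
  is in \<open>V\<close>, and bit 0 is kept for a value of the real. The set for block
  \<open>k + 1\<close> lies in \<open>{..<k + 2}\<close>, so its code takes \<open>k + 3\<close>
  bits; with \<open>k = j + t\<close> this is the modulus.\<close>

primrec state :: "(nat \<Rightarrow> nat set) \<Rightarrow> nat \<Rightarrow> nat \<Rightarrow> (nat \<Rightarrow> nat) \<Rightarrow> nat \<Rightarrow> nat" where
  "state r j y W 0 = y"
| "state r j y W (Suc t) =
     card {i \<in> block (j + t). Suc (index (r i) (W i)) \<in> set_decode (state r j y W t)} mod 2 ^ (j + t + 3)"

text \<open>The value at \<open>t\<close> is bit 0 of the residue of block \<open>j + t\<close>,
  that is, of the state reached after reading this block.\<close>

definition decode :: "(nat \<Rightarrow> nat set) \<Rightarrow> nat \<Rightarrow> nat \<Rightarrow> (nat \<Rightarrow> nat) \<Rightarrow> nat \<Rightarrow> bool" where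
  "decode r j y W t = odd (state r j y W (Suc t))"

lemma set_encode_less:
  assumes "A \<subseteq> {..<n}"
  shows "set_encode A < 2 ^ n"
proof -
  have "set_encode A \<le> (\<Sum>i<n. 2 ^ i)"
    unfolding set_encode_def using assms by (intro sum_mono2) auto
  also have "\<dots> < (2::nat) ^ n"
    by (induction n) auto
  finally show ?thesis .
qed

text \<open>
  The set \<open>V\<close> that \<open>block_coding\<close> provides for a block is encoded in the residue of the preceding
  block; bit \<open>0\<close> of that residue is free to carry a value of \<open>x\<close>. Only the first \<open>V\<close> is part of
  the starting data \<open>j\<close>, \<open>y\<close>.
\<close>

lemma decode_dense:
  assumes r: "r \<in> thin H" and s: "s \<in> boxes H" "Q_sets_le r s"
  obtains q j y where "q \<in> boxes H" "Q_sets_le s q"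
    "\<And>W. (\<And>i. W i \<in> q i) \<Longrightarrow> decode r j y W = x"
proof -
  have r_box: "r \<in> boxes H"
    using r unfolding thin_def by blast
  define attains where "attains k V c \<longleftrightarrow>
      (\<exists>B. (\<forall>i\<in>block k. B i \<subseteq> s i \<and> card (s i) div 2 \<le> card (B i)) \<and>
           (\<forall>W. (\<forall>i\<in>block k. W i \<in> B i) \<longrightarrow>
              card {i \<in> block k. index (r i) (W i) \<in> V} mod 2 ^ (k + 3) = c))" for k V c
  have "\<exists>V\<subseteq>{..<Suc k}. \<forall>c<2 ^ (k + 3). attains k V c" for k
  proof -
    have bij: "bij_betw (index (r i)) (r i) {0..<card (r i)}" for i
      by (rule index_bij[OF boxes_finite[OF r_box]])
    have sub: "s i \<subseteq> r i" for i
      using s(2) unfolding Q_sets_le_def by blast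
    have inj: "inj_on (index (r i)) (s i)" for i
      using bij[of i] sub[of i] unfolding bij_betw_def by (metis inj_on_subset)
    have "index (r i) ` s i \<subseteq> {..<Suc k}" if "i \<in> block k" for i
    proof -
      have "index (r i) ` s i \<subseteq> {0..<card (r i)}"
        using bij[of i] sub[of i] unfolding bij_betw_def by blast
      moreover have "card (r i) \<le> Suc k"
        using r that unfolding thin_def by blast
      ultimately show ?thesis by auto
    qed
    moreover have "2 ^ Suc k * 2 ^ (k + 3) \<le> card (block k)"
      using card_block[of k] by simp
    ultimately show ?thesis
      using block_coding[of "block k" "Suc k" "2 ^ (k + 3)" "\<lambda>i. index (r i)" s] inj
      unfolding attains_def by simp
  qed
  then have "\<forall>k. \<exists>V. V \<subseteq> {..<Suc k} \<and> (\<forall>c<2 ^ (k + 3). attains k V c)"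
    unfolding attains_def by blast
  \<comment> \<open>Since \<open>V k\<close> works for all residues, the sets for all blocks can be
    fixed first; then block \<open>k\<close> can be given the residue that encodes
    \<open>V (Suc k)\<close>.\<close>
  then obtain V where V: "\<And>k. V k \<subseteq> {..<Suc k}"
    and choice: "\<And>k c. c < 2 ^ (k + 3) \<Longrightarrow> attains k (V k) c"
    by metis
  \<comment> \<open>Coordinates of the blocks from \<open>j\<close> on are at least
    \<open>j\<close>, so halving cannot empty any of them.\<close>
  obtain j where j: "\<forall>i\<ge>j. 2 \<le> card (s i)"
    using boxes_large[OF s(1)] by blast
  \<comment> \<open>The value \<open>x t\<close> goes to bit 0 of \<open>code (Suc (j + t))\<close>,
    the residue planned for block \<open>j + t\<close>. The initial code, at \<open>k = j\<close>,
    has bit 0 cleared.\<close>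
  define code where
    "code k = (if k = j then {} else {n. n = 0 \<and> x (k - Suc j)}) \<union> Suc ` V k" for k
  have code_sub: "code k \<subseteq> {..<k + 2}" for k
    using V[of k] unfolding code_def by auto
  then have code_fin: "finite (code k)" for k
    using finite_subset by blast
  have code_Suc: "Suc n \<in> code k \<longleftrightarrow> n \<in> V k" for n k
    unfolding code_def by auto
  have code_0: "0 \<in> code (Suc (j + t)) \<longleftrightarrow> x t" for t
    unfolding code_def by auto
  define y where "y k = set_encode (code k)" for k
  have "y (Suc k) < 2 ^ (k + 3)" for k
    unfolding y_def using set_encode_less[OF code_sub[of "Suc k"]] by (simp add: numeral_eq_Suc)
  then have "\<forall>k. attains k (V k) (y (Suc k))"
    using choice by blast
  then obtain B where B: "\<And>k i. i \<in> block k \<Longrightarrow> B k i \<subseteq> s i \<and> card (s i) div 2 \<le> card (B k i)"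
    and B_card: "\<And>k W. (\<forall>i\<in>block k. W i \<in> B k i) \<Longrightarrow>
              card {i \<in> block k. index (r i) (W i) \<in> V k} mod 2 ^ (k + 3) = y (Suc k)"
    unfolding attains_def choice_iff by blast
  \<comment> \<open>Only blocks from \<open>j\<close> on are shrunk; coordinate 0 and the earlier
    blocks keep \<open>s\<close>.\<close>
  define q where "q i = (if \<exists>k\<ge>j. i \<in> block k then B (THE k. i \<in> block k) i else s i)" for i
  have q_block: "q i = B k i" if "i \<in> block k" "j \<le> k" for i k
  proof -
    have "(THE k. i \<in> block k) = k"
      using that(1) block_unique[OF _ that(1)] by (rule the_equality)
    then show ?thesis
      using that unfolding q_def by auto
  qed
  have q_sub: "q i \<subseteq> s i" and q_card: "card (s i) div 2 \<le> card (q i)" for i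
  proof -
    have "q i \<subseteq> s i \<and> card (s i) div 2 \<le> card (q i)"
    proof (cases "\<exists>k\<ge>j. i \<in> block k")
      case True
      then show ?thesis using B q_block by metis
    next
      case False
      then have "q i = s i"
        unfolding q_def by (rule if_not_P)
      then show ?thesis by simp
    qed
    then show "q i \<subseteq> s i" "card (s i) div 2 \<le> card (q i)" by blast+
  qed
  have "q i \<noteq> {}" for i
  proof (cases "\<exists>k\<ge>j. i \<in> block k")
    case True
    then have "j \<le> i"
      using block_ge by fastforce
    then have "2 \<le> card (s i)"
      using j by blast
    then have "0 < card (q i)"
      using q_card[of i] by linarith
    then show ?thesis by auto
  next
    case False
    then have "q i = s i"
      unfolding q_def by (rule if_not_P)
    then show ?thesis
      using boxes_nonempty[OF s(1)] by simp
  qed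
  moreover have "\<exists>n. \<forall>i\<ge>n. k \<le> card (q i)" for k
  proof -
    obtain n where n: "\<forall>i\<ge>n. 2 * k \<le> card (s i)"
      using boxes_large[OF s(1)] by blast
    have "k \<le> card (q i)" if "n \<le> i" for i
    proof -
      have "k \<le> card (s i) div 2" using n that by auto
      then show ?thesis using q_card[of i] by simp
    qed
    then show ?thesis by blast
  qed
  ultimately have "q \<in> boxes H"
    using boxes_subI[OF s(1) q_sub] by blast
  moreover have "Q_sets_le s q"
    unfolding Q_sets_le_def using q_sub by blast
  moreover have "decode r j (y j) W = x" if W: "\<And>i. W i \<in> q i" for W
  proof -
    \<comment> \<open>By induction the decoder always holds the planned code: the code for a block
      contains its set \<open>V\<close>, relative to which \<open>B\<close> forces the residue to be
      the next code.\<close>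
    have state: "state r j (y j) W t = y (j + t)" for t
    proof (induction t)
      case (Suc t)
      have "W i \<in> B (j + t) i" if "i \<in> block (j + t)" for i
        using W[of i] q_block[OF that] by simp
      then show ?case
        using Suc B_card[of "j + t" W] code_fin by (simp add: y_def code_Suc)
    qed simp
    show ?thesis
    proof
      fix t
      show "decode r j (y j) W t = x t"
        unfolding decode_def state using even_set_encode_iff[OF code_fin] code_0[of t]
        by (simp add: y_def)
    qed
  qed
  ultimately show thesis using that by blast
qed

text \<open>\<open>E n x\<close> consists of the boxes below some \<open>r\<close> in the antichain
  all of whose branches decode to \<open>x\<close> relative to \<open>r\<close>, starting from the
  pair coded by \<open>n\<close>. Density combines maximality of the antichain with
  \<open>decode_dense\<close>.\<close>

lemma boxes_collapse:
  obtains E :: "nat \<Rightarrow> (nat \<Rightarrow> bool) \<Rightarrow> (nat \<Rightarrow> nat set) set"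
  where "\<And>n x. E n x \<subseteq> boxes H"
    and "\<And>n x y s t q. \<lbrakk>s \<in> E n x; t \<in> E n y; q \<in> boxes H; Q_sets_le s q; Q_sets_le t q\<rbrakk> \<Longrightarrow> x = y"
    and "\<And>p x. p \<in> boxes H \<Longrightarrow> \<exists>n. \<exists>q\<in>E n x. Q_sets_le p q"
proof -
  obtain M where M: "M \<subseteq> thin H"
    and antichain: "\<And>p q. \<lbrakk>p \<in> M; q \<in> M; compatible H p q\<rbrakk> \<Longrightarrow> p = q"
    and maximal: "\<And>p. p \<in> boxes H \<Longrightarrow> \<exists>r\<in>M. compatible H p r"
    using thin_maximal_antichain by blast
  define E where "E n x = {q \<in> boxes H. \<exists>r\<in>M. Q_sets_le r q \<and>
      (\<forall>W. (\<forall>i. W i \<in> q i) \<longrightarrow> decode r (fst (prod_decode n)) (snd (prod_decode n)) W = x)}" for n x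
  show thesis
  proof
    show "E n x \<subseteq> boxes H" for n x
      unfolding E_def by blast
  next
    fix n x y s t q
    assume "s \<in> E n x" "t \<in> E n y" and q: "q \<in> boxes H" "Q_sets_le s q" "Q_sets_le t q"
    then obtain r r' where r: "r \<in> M" "Q_sets_le r s" "r' \<in> M" "Q_sets_le r' t"
      and dec: "\<And>W. \<forall>i. W i \<in> s i \<Longrightarrow> decode r (fst (prod_decode n)) (snd (prod_decode n)) W = x"
        "\<And>W. \<forall>i. W i \<in> t i \<Longrightarrow> decode r' (fst (prod_decode n)) (snd (prod_decode n)) W = y"
      unfolding E_def by blast
    \<comment> \<open>The common extension \<open>q\<close> makes \<open>r\<close> and
      \<open>r'\<close> compatible, hence equal; any branch through \<open>q\<close> then decodes to
      both \<open>x\<close> and \<open>y\<close>.\<close>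
    have "r = r'"
      using antichain[OF r(1,3)] r(2,4) q Q_sets_le_trans unfolding compatible_def by blast
    moreover obtain W where "\<forall>i. W i \<in> q i"
      using boxes_nonempty[OF q(1)] by (meson ex_in_conv)
    then have "\<forall>i. W i \<in> s i" "\<forall>i. W i \<in> t i"
      using q(2,3) unfolding Q_sets_le_def by blast+
    ultimately show "x = y"
      using dec by metis
  next
    fix p x
    assume "p \<in> boxes H"
    then obtain r s where r: "r \<in> M" and s: "s \<in> boxes H" "Q_sets_le p s" "Q_sets_le r s"
      using maximal unfolding compatible_def by blast
    obtain q j y where q: "q \<in> boxes H" "Q_sets_le s q"
      and dec: "\<And>W. (\<And>i. W i \<in> q i) \<Longrightarrow> decode r j y W = x"
      using decode_dense[OF subsetD[OF M r] s(1,3), where x = x] by metis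
    have "q \<in> E (prod_encode (j, y)) x"
      unfolding E_def using q r dec Q_sets_le_trans[OF s(3) q(2)] by auto
    then show "\<exists>n. \<exists>q\<in>E n x. Q_sets_le p q"
      using Q_sets_le_trans[OF s(2) q(2)] by blast
  qed
qed

section \<open>Conditions built from creatures\<close>

lemma hc_set_inject: "\<lbrakk>countable A; countable B\<rbrakk> \<Longrightarrow> hc_set A = hc_set B \<longleftrightarrow> A = B"
  unfolding hc_set_def by (simp add: acset_inject)

text \<open>Induction on the datatype is induction along membership, so no set is its own
  element.\<close>

lemma hc_not_in_itself: "x \<notin> rcset (elems x)"
  by (induction x) (metis hc.sel)

lemma elems_hc_nat: "rcset (elems (hc_nat n)) = hc_nat ` {..<n}"
  by (induction n) (simp_all add: cinsert.rep_eq lessThan_Suc bot_cset.rep_eq)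

text \<open>These are the von Neumann numerals: a smaller numeral is an element of a larger one, and
  no set is an element of itself.\<close>

lemma inj_hc_nat: "inj hc_nat"
proof -
  have "hc_nat m \<noteq> hc_nat n" if "m < n" for m n
  proof -
    have "hc_nat m \<in> rcset (elems (hc_nat n))"
      unfolding elems_hc_nat using that by blast
    then show ?thesis
      using hc_not_in_itself by metis
  qed
  then show ?thesis
    by (metis injI linorder_neqE_nat)
qed

lemma hc_pair_inject: "hc_pair x y = hc_pair x' y' \<longleftrightarrow> x = x' \<and> y = y'"
  unfolding hc_pair_def by (auto simp: hc_set_inject doubleton_eq_iff)

text \<open>\<open>Sigma_g\<close> compares creatures only through \<open>dis\<close>, so
  \<open>i\<close> and \<open>A\<close> must be recoverable from it.\<close>

lemma dis_code_inject: "dis_code i A = dis_code j B \<longleftrightarrow> i = j \<and> A = B"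
  unfolding dis_code_def hc_pair_inject
  by (simp add: hc_set_inject inj_image_eq_iff[OF inj_hc_nat] inj_eq[OF inj_hc_nat])

lemma all_less_add:
  fixes m k :: nat
  shows "(\<forall>j<m + k. P j) \<longleftrightarrow> (\<forall>j<m. P j) \<and> (\<forall>i<k. P (m + i))"
proof (intro iffI conjI allI impI)
  fix j
  assume P: "(\<forall>j<m. P j) \<and> (\<forall>i<k. P (m + i))" and "j < m + k"
  show "P j"
  proof (cases "j < m")
    case False
    with \<open>j < m + k\<close> have "j - m < k" "m + (j - m) = j" by linarith+
    with P show ?thesis by metis
  qed (use P in blast)
qed auto

section \<open>The creating pair\<close>

definition g_creature :: "(nat \<Rightarrow> nat) \<Rightarrow> (real \<Rightarrow> real) \<Rightarrow> nat \<Rightarrow> nat set \<Rightarrow> nat creature" where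
  "g_creature H g i A = Creature (g (real (card A)))
     {(u, u @ [a]) | u a. u \<in> seqs (initial_segments H) i \<and> a \<in> A} (dis_code i A)"

definition values_at :: "nat creature \<Rightarrow> nat set" where
  "values_at t = {a. \<exists>u. (u, u @ [a]) \<in> val t}"

locale increasing_norm =
  fixes H :: "nat \<Rightarrow> nat" and g :: "real \<Rightarrow> real"
  assumes H_mono: "strict_mono H" and H_ge: "2 \<le> H 0"
    and g_nonneg: "\<And>x. 0 \<le> x \<Longrightarrow> 0 \<le> g x"
    and g_mono: "mono_on {0..} g"
    and g_unbounded: "\<not> bdd_above (g ` {0..})"
begin

abbreviation "Hs \<equiv> initial_segments H"
abbreviation "K \<equiv> K_g H g"
abbreviation "\<Sigma> \<equiv> Sigma_g H g"
abbreviation "cr \<equiv> g_creature H g"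

lemma H_ge2: "2 \<le> H i"
  using H_ge strict_mono_less_eq[OF H_mono, of 0 i] by linarith

lemma seqs_nonempty: "seqs Hs i \<noteq> {}"
proof -
  have "0 < H j" for j
    using H_ge2[of j] by simp
  then have "replicate i 0 \<in> seqs Hs i"
    unfolding seqs_def initial_segments_def by simp
  then show ?thesis by blast
qed

text \<open>All pairs in \<open>val t\<close> have the same two lengths, and there is at least one
  pair, so the definite descriptions are proper.\<close>

lemma m_dn_up:
  assumes "val t = {(u, u @ [a]) | u a. u \<in> seqs Hs i \<and> a \<in> A}" "A \<noteq> {}"
  shows "m_dn t = i" "m_up t = Suc i"
proof -
  obtain u a where "u \<in> seqs Hs i" "a \<in> A"
    using seqs_nonempty assms(2) by blast
  then have ex: "(u, u @ [a]) \<in> val t" "length u = i"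
    using assms(1) unfolding seqs_def by auto
  have len: "length u = i \<and> length v = Suc i" if "(u, v) \<in> val t" for u v
    using that assms(1) unfolding seqs_def by auto
  show "m_dn t = i"
    unfolding m_dn_def
  proof (rule the_equality)
    show "\<exists>(u, v)\<in>val t. length u = i"
      using ex by (intro bexI[of _ "(u, u @ [a])"]) auto
  qed (use len in blast)
  show "m_up t = Suc i"
    unfolding m_up_def
  proof (rule the_equality)
    show "\<exists>(u, v)\<in>val t. length v = Suc i"
      using ex by (intro bexI[of _ "(u, u @ [a])"]) auto
  qed (use len in blast)
qed

lemma cr_sel [simp]:
  "nor (cr i A) = g (real (card A))"
  "val (cr i A) = {(u, u @ [a]) | u a. u \<in> seqs Hs i \<and> a \<in> A}"
  "dis (cr i A) = dis_code i A"
  unfolding g_creature_def by simp_all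

lemma cr_m [simp]: "A \<noteq> {} \<Longrightarrow> m_dn (cr i A) = i" "A \<noteq> {} \<Longrightarrow> m_up (cr i A) = Suc i"
  using m_dn_up[of "cr i A" i A] by simp_all

lemma values_at_cr [simp]: "values_at (cr i A) = A"
  unfolding values_at_def using seqs_nonempty by auto

lemma cr_in_K:
  assumes "A \<noteq> {}" "A \<subseteq> {..<H i}"
  shows "cr i A \<in> K"
proof -
  have snoc: "u @ [a] \<in> seqs Hs (Suc i)" if "u \<in> seqs Hs i" "a \<in> A" for u a
    using that assms(2) unfolding seqs_def initial_segments_def by (auto simp: nth_append less_Suc_eq)
  have "cr i A \<in> CR Hs"
    unfolding CR_def mem_Collect_eq
  proof (intro conjI)
    show "val (cr i A) \<noteq> {}"
      using assms(1) seqs_nonempty by auto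
    have "val (cr i A) \<subseteq> {(u, v). u \<in> seqs Hs i \<and> v \<in> seqs Hs (Suc i) \<and> prefix u v}"
      using snoc by auto
    then show "\<exists>k l. k < l \<and> val (cr i A) \<subseteq> {(u, v). u \<in> seqs Hs k \<and> v \<in> seqs Hs l \<and> prefix u v}"
      by blast
  qed (simp add: g_nonneg)
  moreover have "forgetful_creature Hs (cr i A)"
    unfolding forgetful_creature_def
  proof (intro ballI impI)
    fix v u
    assume u: "u \<in> seqs Hs (m_dn (cr i A))"
      and "(take (m_dn (cr i A)) v, v) \<in> val (cr i A)"
    then obtain a where "a \<in> A" "v = take i v @ [a]"
      using assms(1) by auto
    moreover from this have "drop i v = [a]"
      by (metis append_take_drop_id same_append_eq)
    ultimately show "(u, u @ drop (m_dn (cr i A)) v) \<in> val (cr i A)"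
      using u assms(1) by simp
  qed
  moreover have "has_pos Hs (cr i A) A"
    unfolding has_pos_def using assms(1) by simp
  ultimately show ?thesis
    unfolding K_g_def using assms by (auto simp: initial_segments_def)
qed

text \<open>The pair of \<open>i\<close> and \<open>A\<close> determines all three components of a
  creature in \<open>K\<close>, with \<open>has_pos\<close> fixing \<open>val\<close>.\<close>

lemma K_eq: "K = {cr i A | i A. A \<noteq> {} \<and> A \<subseteq> {..<H i}}"
proof (intro equalityI subsetI)
  fix t
  assume "t \<in> K"
  then obtain i A where A: "A \<noteq> {}" "A \<subseteq> Hs i" and t: "dis t = dis_code i A"
      "nor t = g (real (card A))" "m_dn t = i" "has_pos Hs t A"
    unfolding K_g_def by blast
  then have "t = cr i A"
    unfolding g_creature_def has_pos_def by (cases t) simp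
  with A show "t \<in> {cr i A | i A. A \<noteq> {} \<and> A \<subseteq> {..<H i}}"
    unfolding initial_segments_def by blast
qed (use cr_in_K in blast)

lemma K_cases:
  assumes "t \<in> K"
  obtains i A where "A \<noteq> {}" "A \<subseteq> {..<H i}" "t = cr i A"
  using assms unfolding K_eq by auto

lemma Sigma_cr:
  assumes "A \<noteq> {}" "A \<subseteq> {..<H i}"
  shows "\<Sigma> (cr i A) = {cr i B | B. B \<noteq> {} \<and> B \<subseteq> A}"
  unfolding Sigma_g_def K_eq using assms by (auto simp: dis_code_inject)

lemma good: "good_creating_pair Hs K \<Sigma>"
proof -
  have "finite (Hs m) \<and> 2 \<le> card (Hs m)" for m
    unfolding initial_segments_def using H_ge2 by simp
  moreover have "K \<subseteq> CR Hs"
    unfolding K_g_def by blast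
  moreover have "\<Sigma> t \<subseteq> K" for t
    unfolding Sigma_g_def by blast
  moreover have "Domain (val t) = seqs Hs (m_dn t) \<and> t \<in> \<Sigma> t \<and> (\<forall>s\<in>\<Sigma> t. val s \<subseteq> val t)
      \<and> (\<forall>s\<in>\<Sigma> t. \<Sigma> s \<subseteq> \<Sigma> t)" if "t \<in> K" for t
  proof -
    obtain i A where A: "A \<noteq> {}" "A \<subseteq> {..<H i}" and t: "t = cr i A"
      using K_cases[OF \<open>t \<in> K\<close>] by metis
    have "Domain (val t) = seqs Hs (m_dn t)"
      using A unfolding t by auto
    moreover have "t \<in> \<Sigma> t"
      unfolding t Sigma_cr[OF A] using A(1) by blast
    moreover have "val s \<subseteq> val t \<and> \<Sigma> s \<subseteq> \<Sigma> t" if s_in: "s \<in> \<Sigma> t" for s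
    proof -
      obtain B where B: "B \<noteq> {}" "B \<subseteq> A" and s: "s = cr i B"
        using s_in unfolding t Sigma_cr[OF A] by blast
      have "B \<subseteq> {..<H i}"
        using A B by blast
      have "val s \<subseteq> val t"
        using B(2) unfolding s t by auto
      moreover have "\<Sigma> s \<subseteq> \<Sigma> t"
        unfolding s t Sigma_cr[OF A] Sigma_cr[OF B(1) \<open>B \<subseteq> {..<H i}\<close>] using B(2) by blast
      ultimately show ?thesis ..
    qed
    ultimately show ?thesis
      by blast
  qed
  ultimately show ?thesis
    unfolding good_creating_pair_def by blast
qed

lemma local: "local_pair K"
  unfolding local_pair_def
proof
  show "m_up t = m_dn t + 1" if "t \<in> K" for t
    using that by (rule K_cases) simp
qed

lemma finitary: "strongly_finitary Hs K"
proof -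
  have "t \<in> cr (m_dn t) ` Pow {..<H (m_dn t)}" if "t \<in> K" for t
    using that by (rule K_cases) simp
  then have "{t \<in> K. m_dn t = i} \<subseteq> cr i ` Pow {..<H i}" for i
    by blast
  then have "finite {t \<in> K. m_dn t = i}" for i
    using finite_subset by blast
  then show ?thesis
    unfolding strongly_finitary_def initial_segments_def by simp
qed

section \<open>Conditions as boxes with a trunk\<close>

text \<open>Monotonicity gives one direction and unboundedness with monotonicity the other. The
  condition on norms thereby becomes the condition on sizes in \<open>boxes\<close>.\<close>

lemma norm_tendsto_iff:
  fixes c :: "nat \<Rightarrow> nat"
  shows "filterlim (\<lambda>n. g (real (c n))) at_top sequentially \<longleftrightarrow> filterlim c at_top sequentially"
proof
  assume lim: "filterlim (\<lambda>n. g (real (c n))) at_top sequentially"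
  show "filterlim c at_top sequentially"
    unfolding filterlim_at_top
  proof
    fix k
    \<comment> \<open>The inequality is taken strict because \<open>g\<close> may be constant on
      intervals: only then does monotonicity exclude \<open>c n < k\<close>.\<close>
    have "eventually (\<lambda>n. g (real k) < g (real (c n))) sequentially"
      using lim unfolding filterlim_at_top_dense by blast
    then show "eventually (\<lambda>n. k \<le> c n) sequentially"
    proof (rule eventually_mono)
      fix n
      assume "g (real k) < g (real (c n))"
      then show "k \<le> c n"
        using mono_onD[OF g_mono, of "real (c n)" "real k"] by force
    qed
  qed
next
  assume lim: "filterlim c at_top sequentially"
  show "filterlim (\<lambda>n. g (real (c n))) at_top sequentially"
    unfolding filterlim_at_top
  proof
    fix Z
    obtain x where x: "0 \<le> x" "Z < g x"
      using g_unbounded unfolding bdd_above_def by (auto simp: not_le)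
    have "eventually (\<lambda>n. nat \<lceil>x\<rceil> \<le> c n) sequentially"
      using lim unfolding filterlim_at_top by blast
    then show "eventually (\<lambda>n. Z \<le> g (real (c n))) sequentially"
    proof (rule eventually_mono)
      fix n
      assume "nat \<lceil>x\<rceil> \<le> c n"
      then have "x \<le> real (c n)" by linarith
      then show "Z \<le> g (real (c n))"
        using mono_onD[OF g_mono, of x "real (c n)"] x by force
    qed
  qed
qed

text \<open>A condition with trunk length \<open>m\<close> is the same thing as a box with singletons below \<open>m\<close>.\<close>

definition trunked :: "nat \<Rightarrow> (nat \<Rightarrow> nat set) set" where
  "trunked m = {A \<in> boxes H. \<forall>i<m. is_singleton (A i)}"

definition word :: "nat \<Rightarrow> (nat \<Rightarrow> nat set) \<Rightarrow> nat list" where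
  "word m A = map (\<lambda>i. the_elem (A i)) [0..<m]"

definition cond :: "nat \<Rightarrow> (nat \<Rightarrow> nat set) \<Rightarrow> nat list \<times> (nat \<Rightarrow> nat creature)" where
  "cond m A = (word m A, \<lambda>n. cr (m + n) (A (m + n)))"

lemma length_word [simp]: "length (word m A) = m"
  unfolding word_def by simp

lemma trunked_singleton: "\<lbrakk>A \<in> trunked m; i < m\<rbrakk> \<Longrightarrow> A i = {word m A ! i}"
  unfolding trunked_def word_def by (auto simp: is_singleton_the_elem)

lemma trunked_box: "A \<in> trunked m \<Longrightarrow> A i \<noteq> {} \<and> A i \<subseteq> {..<H i}"
  unfolding trunked_def boxes_def by blast

lemma word_seqs:
  assumes "A \<in> trunked m"
  shows "word m A \<in> seqs Hs m"
  using trunked_singleton[OF assms] trunked_box[OF assms]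
  unfolding seqs_def initial_segments_def by fastforce

lemma cond_in_Q:
  assumes "A \<in> trunked m"
  shows "cond m A \<in> Q_inf Hs K"
proof -
  have "filterlim (\<lambda>i. card (A i)) at_top sequentially"
    using assms unfolding trunked_def boxes_def by blast
  then have "filterlim (\<lambda>n. card (A (m + n))) at_top sequentially"
    unfolding filterlim_nat_at_top by (meson le_add2 le_trans)
  then have "filterlim (\<lambda>n. g (real (card (A (m + n))))) at_top sequentially"
    unfolding norm_tendsto_iff .
  then show ?thesis
    unfolding Q_inf_def cond_def
    using trunked_box[OF assms] word_seqs[OF assms] by (auto intro!: cr_in_K)
qed

text \<open>Locality makes the creatures occupy consecutive coordinates from the trunk length on;
  the entries of the trunk become singletons below it.\<close>

lemma Q_cond:
  assumes "p \<in> Q_inf Hs K"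
  obtains m A where "A \<in> trunked m" "p = cond m A"
proof -
  obtain w t where p: "p = (w, t)" and t: "\<And>i. t i \<in> K" "\<And>i. m_up (t i) = m_dn (t (Suc i))"
    and w: "w \<in> seqs Hs (m_dn (t 0))" and lim: "filterlim (\<lambda>n. nor (t n)) at_top sequentially"
    using assms unfolding Q_inf_def by blast
  have "\<exists>i B. t n = cr i B \<and> B \<noteq> {} \<and> B \<subseteq> {..<H i}" for n
    using t(1)[of n] unfolding K_eq by blast
  then obtain k B where tk: "\<And>n. t n = cr (k n) (B n)" and B: "\<And>n. B n \<noteq> {}" "\<And>n. B n \<subseteq> {..<H (k n)}"
    by metis
  define m where "m = k 0"
  have k: "k n = m + n" for n
  proof (induction n)
    case (Suc n)
    then show ?case using t(2)[of n] B by (simp add: tk)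
  qed (simp add: m_def)
  have w_len: "length w = m" and w_in: "\<And>i. i < m \<Longrightarrow> w ! i < H i"
    using w B unfolding m_def tk seqs_def initial_segments_def by auto
  define A where "A i = (if i < m then {w ! i} else B (i - m))" for i
  have A_B: "A (m + n) = B n" for n
    unfolding A_def by simp
  have "filterlim (\<lambda>n. card (B n)) at_top sequentially"
    using lim unfolding tk by (simp add: norm_tendsto_iff)
  then have "\<exists>n. \<forall>i\<ge>n. c \<le> card (A i)" for c
  proof -
    obtain n where n: "\<forall>i\<ge>n. c \<le> card (B i)"
      using \<open>filterlim (\<lambda>n. card (B n)) at_top sequentially\<close> unfolding filterlim_nat_at_top by blast
    have "c \<le> card (A i)" if "m + n \<le> i" for i
      using n that unfolding A_def by simp
    then show ?thesis by blast
  qed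
  moreover have "A i \<subseteq> {..<H i} \<and> A i \<noteq> {}" for i
    using B(1)[of "i - m"] B(2)[of "i - m"] w_in unfolding A_def k by auto
  moreover have "is_singleton (A i)" if "i < m" for i
    using that unfolding A_def by simp
  ultimately have "A \<in> trunked m"
    unfolding trunked_def boxes_def filterlim_nat_at_top by blast
  moreover have "word m A = w"
    unfolding word_def using w_len by (intro nth_equalityI) (simp_all add: A_def)
  then have "p = cond m A"
    unfolding p cond_def using tk k A_B by auto
  ultimately show thesis using that by blast
qed

lemma cr_in_Sigma_iff:
  assumes "A \<noteq> {}" "A \<subseteq> {..<H i}" "B \<noteq> {}"
  shows "cr j B \<in> \<Sigma> (cr i A) \<longleftrightarrow> i = j \<and> B \<subseteq> A"
proof -
  have "i = j \<and> B = C" if "cr j B = cr i C" for C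
    using arg_cong[OF that, of dis] by (simp add: dis_code_inject)
  then show ?thesis
    unfolding Sigma_cr[OF assms(1,2)] using assms(3) by blast
qed

text \<open>The possibilities are the finite branches through the box: the prefix clause handles the
  coordinates below \<open>m\<close>, and the \<open>i\<close>-th creature handles coordinate
  \<open>m + i\<close>.\<close>

lemma poss_iff:
  assumes A: "A \<in> trunked m" and v: "v \<in> seqs Hs (m + k)"
  shows "v \<in> poss Hs (word m A) (\<lambda>n. cr (m + n) (A (m + n))) k \<longleftrightarrow> (\<forall>j<m + k. v ! j \<in> A j)"
proof -
  have len: "length v = m + k"
    using v unfolding seqs_def by simp
  have "prefix (word m A) v \<longleftrightarrow> (\<forall>j<m. v ! j = word m A ! j)"
    using len by (auto simp: prefix_def nth_append list_eq_iff_nth_eq intro!: exI[of _ "drop m v"])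
  also have "\<dots> \<longleftrightarrow> (\<forall>j<m. v ! j \<in> A j)"
    using trunked_singleton[OF A] by simp
  finally have pre: "prefix (word m A) v \<longleftrightarrow> (\<forall>j<m. v ! j \<in> A j)" .
  have step: "(take (m + i) v, take (Suc (m + i)) v) \<in> val (cr (m + i) (A (m + i))) \<longleftrightarrow> v ! (m + i) \<in> A (m + i)"
    if "i < k" for i
  proof -
    have "take (m + i) v \<in> seqs Hs (m + i)"
      using v that unfolding seqs_def by auto
    then show ?thesis
      using that len by (auto simp: take_Suc_conv_app_nth)
  qed
  have split: "(\<forall>j<m + k. v ! j \<in> A j) \<longleftrightarrow> (\<forall>j<m. v ! j \<in> A j) \<and> (\<forall>i<k. v ! (m + i) \<in> A (m + i))"
    by (rule all_less_add)
  show ?thesis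
  proof (cases "k = 0")
    case True
    have "v = word m A \<longleftrightarrow> prefix (word m A) v"
      using len True
      by (metis add_cancel_right_right append_Nil2 length_0_conv length_append length_word prefix_def prefix_order.refl)
    then show ?thesis
      using True pre unfolding poss_def by simp
  next
    case False
    then have "Suc (m + (k - 1)) = m + k" by simp
    then show ?thesis
      using False v pre step trunked_box[OF A] unfolding split poss_def by simp
  qed
qed

text \<open>The number of creatures absorbed into the trunk must be \<open>m' - m\<close>. Below
  \<open>m'\<close>, where \<open>A'\<close> has singletons, inclusion says that the new trunk is a
  possibility; from \<open>m'\<close> on it is the condition given by
  \<open>\<Sigma>\<close>.\<close>

lemma Q_inf_le_cond:
  assumes A: "A \<in> trunked m" and A': "A' \<in> trunked m'"
  shows "Q_inf_le Hs \<Sigma> (cond m A) (cond m' A') \<longleftrightarrow> m \<le> m' \<and> Q_sets_le A A'"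
proof -
  have sigma: "(\<forall>n. cr (m' + n) (A' (m' + n)) \<in> \<Sigma> (cr (m + (n + k)) (A (m + (n + k))))) \<longleftrightarrow>
      m' = m + k \<and> (\<forall>n. A' (m' + n) \<subseteq> A (m' + n))" for k
    using trunked_box[OF A] trunked_box[OF A'] by (auto simp: cr_in_Sigma_iff add_ac)
  have word: "word m' A' \<in> poss Hs (word m A) (\<lambda>n. cr (m + n) (A (m + n))) k \<longleftrightarrow> (\<forall>j<m'. A' j \<subseteq> A j)"
    if "m' = m + k" for k
    using poss_iff[OF A, of "word m' A'" k] word_seqs[OF A'] trunked_singleton[OF A'] that by simp
  have "Q_inf_le Hs \<Sigma> (cond m A) (cond m' A') \<longleftrightarrow>
      (\<exists>k. m' = m + k \<and> (\<forall>j<m'. A' j \<subseteq> A j) \<and> (\<forall>n. A' (m' + n) \<subseteq> A (m' + n)))"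
    unfolding Q_inf_le_def cond_def prod.case sigma using word by metis
  also have "\<dots> \<longleftrightarrow> m \<le> m' \<and> (\<forall>j. A' j \<subseteq> A j)"
    by (metis le_add_diff_inverse le_iff_add not_le)
  finally show ?thesis
    unfolding Q_sets_le_def .
qed

lemma forcing_Q: "forcing_notion (Q_inf Hs K) (Q_inf_le Hs \<Sigma>)"
proof
  have "i \<le> H i" for i
    using strict_mono_imp_increasing[OF H_mono] .
  then have "\<exists>n. \<forall>i\<ge>n. k \<le> H i" for k
    by (meson le_trans)
  moreover have "0 < H i" for i
    using H_ge2[of i] by simp
  ultimately have "(\<lambda>i. {..<H i}) \<in> trunked 0"
    unfolding trunked_def boxes_def filterlim_nat_at_top by (simp add: lessThan_empty_iff)
  then show "Q_inf Hs K \<noteq> {}"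
    using cond_in_Q by blast
next
  fix p
  assume "p \<in> Q_inf Hs K"
  then show "Q_inf_le Hs \<Sigma> p p"
    by (metis Q_cond Q_inf_le_cond Q_sets_le_refl order_refl)
next
  fix p q r
  assume "p \<in> Q_inf Hs K" "q \<in> Q_inf Hs K" "r \<in> Q_inf Hs K" "Q_inf_le Hs \<Sigma> p q" "Q_inf_le Hs \<Sigma> q r"
  then show "Q_inf_le Hs \<Sigma> p r"
    by (elim Q_cond) (auto simp: Q_inf_le_cond intro: Q_sets_le_trans)
qed

text \<open>The sets \<open>E n x\<close> are carried over along \<open>cond\<close>. An extension
  of a box stays a condition with the same trunk, since a nonempty subset of a singleton is that
  singleton.\<close>

lemma collapses_Q: "forcing_notion.collapses_continuum (Q_inf Hs K) (Q_inf_le Hs \<Sigma>)"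
proof -
  interpret forcing_notion "Q_inf Hs K" "Q_inf_le Hs \<Sigma>"
    by (rule forcing_Q)
  obtain E :: "nat \<Rightarrow> (nat \<Rightarrow> bool) \<Rightarrow> (nat \<Rightarrow> nat set) set" where sub: "\<And>n x. E n x \<subseteq> boxes H"
    and incompat: "\<And>n x y s t q. \<lbrakk>s \<in> E n x; t \<in> E n y; q \<in> boxes H; Q_sets_le s q; Q_sets_le t q\<rbrakk> \<Longrightarrow> x = y"
    and dense: "\<And>p x. p \<in> boxes H \<Longrightarrow> \<exists>n. \<exists>q\<in>E n x. Q_sets_le p q"
    using boxes_collapse[of H] by blast
  define F where "F n x = {cond m A | m A. A \<in> trunked m \<and> A \<in> E n x}" for n x
  show ?thesis
    unfolding collapses_continuum_def
  proof (rule forced_f_countable[of UNIV F])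
    show "F n x \<subseteq> Q_inf Hs K" for n x
      unfolding F_def using cond_in_Q by blast
  next
    fix n x y s t q
    assume "s \<in> F n x" "t \<in> F n y" "q \<in> Q_inf Hs K" "Q_inf_le Hs \<Sigma> s q" "Q_inf_le Hs \<Sigma> t q"
    moreover obtain m A where "A \<in> trunked m" "q = cond m A"
      using Q_cond \<open>q \<in> Q_inf Hs K\<close> by blast
    ultimately show "x = y"
      unfolding F_def using incompat[of _ n x _ y A] by (auto simp: Q_inf_le_cond trunked_def)
  next
    fix p and x :: "nat \<Rightarrow> bool"
    assume "p \<in> Q_inf Hs K"
    then obtain m A where A: "A \<in> trunked m" "p = cond m A"
      using Q_cond by blast
    then obtain n B where B: "B \<in> E n x" "Q_sets_le A B"
      using dense[of A x] unfolding trunked_def by blast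
    have "is_singleton (B i)" if "i < m" for i
    proof -
      have "B i \<noteq> {}" "B i \<subseteq> A i"
        using B sub boxes_nonempty unfolding Q_sets_le_def by blast+
      then show ?thesis
        using trunked_singleton[OF A(1) that] by (auto simp: subset_singleton_iff)
    qed
    then have "B \<in> trunked m"
      using B sub unfolding trunked_def by blast
    then have "cond m B \<in> F n x" "Q_inf_le Hs \<Sigma> p (cond m B)"
      unfolding F_def using A B by (blast, simp add: Q_inf_le_cond)
    then show "\<exists>n. \<exists>q\<in>F n x. Q_inf_le Hs \<Sigma> p q"
      by blast
  qed
qed

end

section \<open>The forcing notion of sequences of finite sets\<close>

lemma forcing_Q_sets: "forcing_notion Q_sets Q_sets_le"
proof
  have "(\<lambda>n. {..<2 ^ n}) \<in> Q_sets"
    unfolding Q_sets_def filterlim_nat_at_top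
    by (auto simp: lessThan_empty_iff) (meson le_trans less_exp less_imp_le)
  then show "Q_sets \<noteq> {}" by blast
qed (use Q_sets_le_refl Q_sets_le_trans in blast)+

text \<open>The same collapse, applied to a copy of the reals of the type over which properness
  quantifies.\<close>

lemma Q_sets_not_proper: "\<not> forcing_notion.proper Q_sets Q_sets_le"
proof -
  interpret forcing_notion Q_sets Q_sets_le
    by (rule forcing_Q_sets)
  obtain E :: "nat \<Rightarrow> (nat \<Rightarrow> bool) \<Rightarrow> (nat \<Rightarrow> nat set) set" where sub: "\<And>n x. E n x \<subseteq> Q_sets"
    and incompat: "\<And>n x y s t q. \<lbrakk>s \<in> E n x; t \<in> E n y; q \<in> Q_sets; Q_sets_le s q; Q_sets_le t q\<rbrakk> \<Longrightarrow> x = y"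
    and dense: "\<And>p x. p \<in> Q_sets \<Longrightarrow> \<exists>n. \<exists>q\<in>E n x. Q_sets_le p q"
    using boxes_collapse[of "\<lambda>n. 2 ^ n"] unfolding Q_sets_eq_boxes by blast
  \<comment> \<open>Each real is copied as the singleton of its characteristic sequence, with
    \<open>{0}\<close> for true and \<open>{}\<close> for false.\<close>
  define e :: "(nat \<Rightarrow> bool) \<Rightarrow> (nat \<Rightarrow> nat set) set" where "e x = {\<lambda>n. if x n then {0} else {}}" for x
  have "inj e"
  proof
    fix x y
    assume "e x = e y"
    then have "(\<lambda>n. if x n then {0::nat} else {}) = (\<lambda>n. if y n then {0} else {})"
      unfolding e_def by simp
    then have "x n = y n" for n
      by (metis insert_not_empty)
    then show "x = y" by blast
  qed
  have "uncountable (UNIV :: (nat \<Rightarrow> bool) set)"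
  proof
    assume "countable (UNIV :: (nat \<Rightarrow> bool) set)"
    then obtain h :: "nat \<Rightarrow> nat \<Rightarrow> bool" where h: "range h = UNIV"
      using uncountable_def by (metis UNIV_not_empty)
    then obtain n where "h n = (\<lambda>k. \<not> h k k)"
      by (metis UNIV_I imageE)
    then show False by metis
  qed
  then have "uncountable (range e)"
    using \<open>inj e\<close> by (simp add: countable_image_inj_eq)
  moreover have "forced (f_countable (range e) (check (range e)))"
  proof (rule forced_f_countable[of "range e" "\<lambda>n. E n \<circ> inv e"])
    fix n x y s t q
    assume "x \<in> range e" "y \<in> range e" and "s \<in> (E n \<circ> inv e) x" "t \<in> (E n \<circ> inv e) y"
      "q \<in> Q_sets" "Q_sets_le s q" "Q_sets_le t q"
    then show "x = y"
      using incompat[of s n "inv e x" t "inv e y" q] by (metis comp_apply f_inv_into_f)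
  qed (use sub dense in auto)
  ultimately show ?thesis
    by (rule not_proper_if_collapses_uncountable)
qed

theorem corollary2p8:
  fixes H :: "nat \<Rightarrow> nat" and g :: "real \<Rightarrow> real"
  assumes "strict_mono H" and "2 \<le> H 0"
    and "\<And>x. 0 \<le> x \<Longrightarrow> 0 \<le> g x"
    and "mono_on {0..} g"
    and "\<not> bdd_above (g ` {0..})"
  shows "good_creating_pair (initial_segments H) (K_g H g) (Sigma_g H g)
       \<and> local_pair (K_g H g)
       \<and> strongly_finitary (initial_segments H) (K_g H g)
       \<and> forcing_notion (Q_inf (initial_segments H) (K_g H g))
           (Q_inf_le (initial_segments H) (Sigma_g H g))
       \<and> forcing_notion.collapses_continuum (Q_inf (initial_segments H) (K_g H g))
           (Q_inf_le (initial_segments H) (Sigma_g H g))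
       \<and> forcing_notion Q_sets Q_sets_le
       \<and> \<not> forcing_notion.proper Q_sets Q_sets_le"
proof -
  interpret increasing_norm H g
    using assms by unfold_locales auto
  show ?thesis
    using good local finitary forcing_Q collapses_Q forcing_Q_sets Q_sets_not_proper by blast
qed


end
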